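(* Let $(G,Z)\neq(\{1\},\emptyset)$. For every $n\ge 1$ the Poincaré series of $X_n$ is $$P_{X_n}(t)=\prod_{k=1}^n(1+\alpha_k t),\qquad \alpha_k=|G|(k-1)+|Z|-1 .$$
   Context: $\mathbb P^1$ is the complex projective line with $\mathrm{PGL}(\mathbb C^2)$ acting by homographies. $G$ is a finite subgroup of $\mathrm{PGL}(\mathbb C^2)$ and $Z\subset\mathbb P^1$ is a finite $G$-stable set containing all points of $\mathbb P^1$ with non-trivial stabilizer in $G$. $X_n=\{(p_1,\dots,p_n)\in(\mathbb P^1\setminus Z)^n\mid p_i\ne g\cdot p_j\text{ for all }i\neq j,\ g\in G\}$. The Poincaré series of a space $X$ is $\sum_{k\ge0}\mathrm{rank}\,H_k(X,\mathbb Z)\,t^k$. *)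

theory Defs
  imports
    "HOL-Analysis.Analysis"
    "HOL-Algebra.Group_Action"
    "HOL-Homology.Homology"
    "HOL-Library.Extended_Nat"
    "HOL-Computational_Algebra.Formal_Power_Series"
begin

section \<open>The complex projective line\<close>

text \<open>A point of the projective line is a class of proportional nonzero vectors, i.e.
  a line through the origin with the origin removed.\<close>

definition proj_rel :: "((complex^2) \<times> (complex^2)) set" where
  "proj_rel = {(v, w). v \<noteq> 0 \<and> w \<noteq> 0 \<and> (\<exists>c::complex. c \<noteq> 0 \<and> w = c *s v)}"

definition proj_line :: "(complex^2) set set" where
  "proj_line = (UNIV - {0}) // proj_rel"

definition proj_line_top :: "(complex^2) set topology" where
  "proj_line_top =
     topology (\<lambda>U. U \<subseteq> proj_line \<and> open {v. v \<noteq> 0 \<and> proj_rel `` {v} \<in> U})"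

lemma openin_proj_line_top:
  "openin proj_line_top U \<longleftrightarrow> U \<subseteq> proj_line \<and> open {v. v \<noteq> 0 \<and> proj_rel `` {v} \<in> U}"
proof -
  define V where "V = (\<lambda>U. {v. v \<noteq> 0 \<and> proj_rel `` {v} \<in> U})"
  have int: "V (S \<inter> T) = V S \<inter> V T" for S T
    by (auto simp: V_def)
  have un: "V (\<Union>K) = (\<Union>S\<in>K. V S)" for K
    by (auto simp: V_def)
  have "istopology (\<lambda>U. U \<subseteq> proj_line \<and> open (V U))"
    unfolding istopology_def by (auto simp: int un)
  then show ?thesis
    unfolding proj_line_top_def V_def by (simp add: topology_inverse')
qed

lemma topspace_proj_line_top: "topspace proj_line_top = proj_line"
proof -
  have "{v. v \<noteq> 0 \<and> proj_rel `` {v} \<in> proj_line} = - {0}"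
    by (auto simp: proj_line_def quotient_def)
  then have "openin proj_line_top proj_line"
    by (simp add: openin_proj_line_top open_Compl)
  then show ?thesis
    by (metis openin_proj_line_top openin_subset openin_topspace subset_antisym)
qed

lemma quotient_map_proj_line:
  "quotient_map (top_of_set (UNIV - {0})) proj_line_top (\<lambda>v. proj_rel `` {v})"
proof -
  have "openin (top_of_set (UNIV - {0})) {x. x \<noteq> 0 \<and> P x} \<longleftrightarrow> open {x::complex^2. x \<noteq> 0 \<and> P x}" for P
    by (subst openin_open_eq) (auto simp: open_delete)
  then show ?thesis
    by (auto simp: quotient_map_def topspace_proj_line_top openin_proj_line_top
        proj_line_def quotient_def)
qed


section \<open>The projective linear group and homographies\<close>

definition GL2 :: "(complex^2^2) monoid" where
  "GL2 = \<lparr>carrier = {A. invertible A}, mult = (**), one = mat 1\<rparr>"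

definition scalars2 :: "(complex^2^2) set" where
  "scalars2 = {mat c | c. c \<noteq> 0}"

definition PGL2 :: "(complex^2^2) set monoid" where
  "PGL2 = GL2 Mod scalars2"

text \<open>Elements of \<^const>\<open>PGL2\<close> are classes of matrices and points are classes of vectors;
  all products of representatives form the image point.\<close>

definition homography :: "(complex^2^2) set \<Rightarrow> (complex^2) set \<Rightarrow> (complex^2) set" where
  "homography g p = {A *v v | A v. A \<in> g \<and> v \<in> p}"

lemma homography_class:
  assumes "invertible A" "v \<noteq> 0"
  shows "homography (scalars2 #>\<^bsub>GL2\<^esub> A) (proj_rel `` {v}) = proj_rel `` {A *v v}"
proof -
  have nz: "A *v w \<noteq> 0" if "w \<noteq> 0" for w
    using that assms(1) by (metis invertible_def matrix_vector_mul_assoc matrix_vector_mul_lid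
        matrix_vector_mult_0_right)
  have sc: "(mat a ** A) *v (c *s v) = (a * c) *s (A *v v)" for a c
  proof -
    have m: "mat a *v x = a *s x" for x :: "complex^2"
      by (simp add: vec_eq_iff matrix_vector_mult_def mat_def forall_2 sum_2)
    show ?thesis
      by (simp add: matrix_vector_mul_assoc [symmetric] m vector_scalar_commute
          vector_smult_assoc)
  qed
  have cl: "proj_rel `` {w} = {c *s w | c. c \<noteq> 0}" if "w \<noteq> 0" for w
    using that by (auto simp: proj_rel_def)
  have co: "scalars2 #>\<^bsub>GL2\<^esub> A = {mat a ** A | a. a \<noteq> 0}"
    by (auto simp: r_coset_def scalars2_def GL2_def)
  have "homography (scalars2 #>\<^bsub>GL2\<^esub> A) (proj_rel `` {v})
      = {(a * c) *s (A *v v) | a c. a \<noteq> 0 \<and> c \<noteq> 0}"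
    unfolding homography_def co cl[OF assms(2)] by (force simp: sc)
  also have "\<dots> = {c *s (A *v v) | c. c \<noteq> 0}"
  proof -
    have "\<exists>a b. c *s (A *v v) = (a * b) *s (A *v v) \<and> a \<noteq> 0 \<and> b \<noteq> 0" if "c \<noteq> 0" for c
      using that by (intro exI[of _ 1] exI[of _ c]) simp
    moreover have "a * b \<noteq> 0" if "a \<noteq> 0" "b \<noteq> 0" for a b :: complex
      using that by simp
    ultimately show ?thesis by blast
  qed
  also have "\<dots> = proj_rel `` {A *v v}"
    using cl nz assms(2) by simp
  finally show ?thesis .
qed

lemma group_GL2: "group GL2"
proof (rule groupI)
  fix x assume "x \<in> carrier GL2"
  then show "\<exists>y\<in>carrier GL2. y \<otimes>\<^bsub>GL2\<^esub> x = \<one>\<^bsub>GL2\<^esub>"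
    by (simp add: GL2_def) (metis invertible_def)
qed (auto simp: GL2_def invertible_mult matrix_mul_assoc invertible_def[of "mat 1"])

lemma scalars2_normal: "scalars2 \<lhd> GL2"
proof -
  interpret group GL2 by (rule group_GL2)
  have mm: "mat a ** mat b = (mat (a * b) :: complex^2^2)" for a b
    by (simp add: vec_eq_iff matrix_matrix_mult_def mat_def forall_2 sum_2)
  have comm: "mat a ** A = A ** mat a" for a and A :: "complex^2^2"
    by (simp add: vec_eq_iff matrix_matrix_mult_def mat_def forall_2 sum_2 mult.commute)
  have sub: "scalars2 \<subseteq> carrier GL2"
  proof
    fix A assume "A \<in> scalars2"
    then obtain a where a: "A = mat a" "a \<noteq> 0" by (auto simp: scalars2_def)
    then have "A ** mat (inverse a) = mat 1" "mat (inverse a) ** A = mat 1"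
      by (simp_all add: mm)
    then show "A \<in> carrier GL2"
      unfolding GL2_def invertible_def by auto
  qed
  have "subgroup scalars2 GL2"
  proof (rule subgroupI)
    show "scalars2 \<noteq> {}" by (auto simp: scalars2_def intro: exI[of _ 1])
    fix A assume A: "A \<in> scalars2"
    then obtain a where a: "A = mat a" "a \<noteq> 0" by (auto simp: scalars2_def)
    then have i: "mat (inverse a) \<in> scalars2" by (auto simp: scalars2_def)
    have "inv\<^bsub>GL2\<^esub> A = mat (inverse a)"
    proof (rule inv_equality)
      show "mat (inverse a) \<otimes>\<^bsub>GL2\<^esub> A = \<one>\<^bsub>GL2\<^esub>"
        using a by (simp add: GL2_def mm)
    qed (use A i sub in auto)
    with i show "inv\<^bsub>GL2\<^esub> A \<in> scalars2" by simp
  next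
    fix A B assume "A \<in> scalars2" "B \<in> scalars2"
    then show "A \<otimes>\<^bsub>GL2\<^esub> B \<in> scalars2"
      by (auto simp: scalars2_def GL2_def mm)
  qed (rule sub)
  moreover have "scalars2 #>\<^bsub>GL2\<^esub> A = A <#\<^bsub>GL2\<^esub> scalars2" for A
    unfolding r_coset_def l_coset_def by (rule SUP_cong) (auto simp: GL2_def scalars2_def comm[of _ A])
  ultimately show ?thesis
    by (simp add: normal_def normal_axioms_def group_axioms)
qed

lemma group_PGL2: "group PGL2"
  unfolding PGL2_def by (rule normal.factorgroup_is_group[OF scalars2_normal])


section \<open>Orbit configuration spaces\<close>

definition orbit_conf_space ::
    "(complex^2^2) set set \<Rightarrow> (complex^2) set set \<Rightarrow> nat \<Rightarrow> (nat \<Rightarrow> (complex^2) set) topology"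
  where
  "orbit_conf_space G Z n =
     subtopology (product_topology (\<lambda>_. proj_line_top) {1..n})
       {p \<in> {1..n} \<rightarrow>\<^sub>E (proj_line - Z).
          \<forall>i\<in>{1..n}. \<forall>j\<in>{1..n}. i \<noteq> j \<longrightarrow> (\<forall>g\<in>G. p i \<noteq> homography g (p j))}"


section \<open>Rank of abelian groups and Poincare series\<close>

definition int_independent :: "('a, 'b) monoid_scheme \<Rightarrow> 'a set \<Rightarrow> bool" where
  "int_independent A S \<longleftrightarrow> finite S \<and> S \<subseteq> carrier A \<and>
     (\<forall>c::'a \<Rightarrow> int. finprod A (\<lambda>x. x [^]\<^bsub>A\<^esub> c x) S = \<one>\<^bsub>A\<^esub> \<longrightarrow> (\<forall>x\<in>S. c x = 0))"

definition group_rank :: "('a, 'b) monoid_scheme \<Rightarrow> enat" where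
  "group_rank A = (SUP S \<in> {S. int_independent A S}. enat (card S))"

text \<open>An infinite rank has no meaningful image under \<^const>\<open>the_enat\<close>: the series
  is to be used for spaces all of whose homology groups have finite rank.\<close>

definition finite_betti :: "'a topology \<Rightarrow> bool" where
  "finite_betti X \<longleftrightarrow> (\<forall>k::nat. group_rank (homology_group (int k) X) \<noteq> \<infinity>)"

definition poincare_series :: "'a topology \<Rightarrow> int fps" where
  "poincare_series X =
     Abs_fps (\<lambda>k. int (the_enat (group_rank (homology_group (int k) X))))"

end

theory Submission
  imports Defs
begin

text \<open>
  A nontrivial homography has a fixed point, so \<open>Z\<close> contains some point, which serves as
  infinity: all coordinates of a configuration then lie in the complex plane. Forgetting the last
  point turns \<open>X\<^sub>n\<^sub>+\<^sub>1\<close> into the complement of \<open>m = |Z| - 1 + n|G|\<close> pairwise disjoint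
  sections of the trivial plane bundle over \<open>X\<^sub>n\<close>. For such a complement \<open>E\<close> over any base
  \<open>B\<close>, a section near infinity splits the long exact sequence of \<open>(B \<times> \<complex>, E)\<close>, whence
  \<open>H\<^sub>k(E) \<cong> H\<^sub>k(B) \<oplus> H\<^sub>k\<^sub>+\<^sub>1(B \<times> \<complex>, E)\<close>. The relative Mayer--Vietoris argument
  breaks the relative group up into one summand for each section, and each summand is
  \<open>H\<^sub>k\<^sub>-\<^sub>1(B)\<close>. All homology groups are thus free, and the Poincare series is multiplied by
  \<open>1 + m t\<close>.
\<close>

section \<open>Free abelian groups of finite rank\<close>

text \<open>The index set \<open>{..<r}\<close> makes the rank a plain number. Freeness is carried
  through the whole induction, since it passes to direct products; \<open>group_rank\<close> is
  evaluated only at the end.\<close>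

definition free_of_rank :: "('a, 'b) monoid_scheme \<Rightarrow> nat \<Rightarrow> bool" where
  "free_of_rank G r \<longleftrightarrow> G \<cong> free_Abelian_group {..<r}"

lemma free_of_rank_iso:
  assumes "G \<cong> H" "free_of_rank H r"
  shows "free_of_rank G r"
  using assms iso_trans unfolding free_of_rank_def by blast

lemma free_of_rank_trivial:
  assumes "group G" "trivial_group G"
  shows "free_of_rank G 0"
proof -
  have "carrier G = {\<one>\<^bsub>G\<^esub>}" "\<one>\<^bsub>G\<^esub> \<otimes>\<^bsub>G\<^esub> \<one>\<^bsub>G\<^esub> = \<one>\<^bsub>G\<^esub>"
    using assms by (auto simp: trivial_group_def group.is_monoid monoid.l_one monoid.one_closed)
  moreover have "carrier (free_Abelian_group ({} :: nat set)) = {0}"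
    by (auto simp: free_Abelian_group_def)
  ultimately have "(\<lambda>_. 0) \<in> iso G (free_Abelian_group ({} :: nat set))"
    by (intro isoI homI) (auto simp: bij_betw_def)
  then show ?thesis
    by (auto simp: free_of_rank_def is_iso_def)
qed

lemma free_of_rank_integer: "free_of_rank integer_group 1"
  using isomorphic_group_integer_free_Abelian_group_singleton[of "0::nat"]
  by (simp add: free_of_rank_def lessThan_Suc)

text \<open>Two decompositions of the same formal sum differ by an element supported in both
  \<open>S\<close> and \<open>T\<close>, hence by 0; conversely, a formal sum over the union is
  split according to its support.\<close>

lemma free_Abelian_group_Un_iso:
  fixes S T :: "'a set"
  assumes "S \<inter> T = {}"
  shows "(\<lambda>(x, y). x + y) \<in> iso (free_Abelian_group S \<times>\<times> free_Abelian_group T) (free_Abelian_group (S \<union> T))"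
proof (rule isoI)
  have keys: "Poly_Mapping.keys (a + b) \<subseteq> S \<union> T"
    if "Poly_Mapping.keys a \<subseteq> S" "Poly_Mapping.keys b \<subseteq> T" for a b :: "'a \<Rightarrow>\<^sub>0 int"
    using keys_add[of a b] that by blast
  show "(\<lambda>(x, y). x + y) \<in> hom (free_Abelian_group S \<times>\<times> free_Abelian_group T) (free_Abelian_group (S \<union> T))"
    by (rule homI) (use keys in \<open>force simp: algebra_simps\<close>)+
  show "bij_betw (\<lambda>(x, y). x + y) (carrier (free_Abelian_group S \<times>\<times> free_Abelian_group T))
     (carrier (free_Abelian_group (S \<union> T)))"
    unfolding bij_betw_def
  proof
    have "x = x' \<and> y = y'"
      if "Poly_Mapping.keys x \<subseteq> S" "Poly_Mapping.keys x' \<subseteq> S" "Poly_Mapping.keys y \<subseteq> T"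
        "Poly_Mapping.keys y' \<subseteq> T" "x + y = x' + y'" for x x' y y' :: "'a \<Rightarrow>\<^sub>0 int"
    proof -
      have "x - x' = y' - y"
        using that by (simp add: algebra_simps)
      moreover have "Poly_Mapping.keys (x - x') \<subseteq> S"
        by (rule order_trans[OF keys_diff Un_least[OF that(1,2)]])
      moreover have "Poly_Mapping.keys (y' - y) \<subseteq> T"
        by (rule order_trans[OF keys_diff Un_least[OF that(4,3)]])
      ultimately have "Poly_Mapping.keys (x - x') = {}"
        using assms by (metis Int_greatest subset_empty)
      with \<open>x - x' = y' - y\<close> show ?thesis by simp
    qed
    then show "inj_on (\<lambda>(x, y). x + y) (carrier (free_Abelian_group S \<times>\<times> free_Abelian_group T))"
      by (auto simp: inj_on_def)
    show "(\<lambda>(x, y). x + y) ` carrier (free_Abelian_group S \<times>\<times> free_Abelian_group T)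
        = carrier (free_Abelian_group (S \<union> T))"
    proof (intro equalityI subsetI)
      fix c assume "c \<in> carrier (free_Abelian_group (S \<union> T))"
      then obtain x y where "Poly_Mapping.keys x \<subseteq> S" "Poly_Mapping.keys y \<subseteq> T" "c = x + y"
        using frag_split[of c S T] by (metis carrier_free_Abelian_group_iff)
      then show "c \<in> (\<lambda>(x, y). x + y) ` carrier (free_Abelian_group S \<times>\<times> free_Abelian_group T)"
        by (intro image_eqI[of _ _ "(x, y)"]) auto
    next
      fix c assume "c \<in> (\<lambda>(x, y). x + y) ` carrier (free_Abelian_group S \<times>\<times> free_Abelian_group T)"
      then obtain x y where "Poly_Mapping.keys x \<subseteq> S" "Poly_Mapping.keys y \<subseteq> T" "c = x + y"
        by auto
      then show "c \<in> carrier (free_Abelian_group (S \<union> T))"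
        using keys by (simp only: carrier_free_Abelian_group_iff)
    qed
  qed
qed

lemma free_of_rank_DirProd:
  assumes "group G" "group H" "free_of_rank G r" "free_of_rank H s"
  shows "free_of_rank (G \<times>\<times> H) (r + s)"
proof -
  \<comment> \<open>Shifting the basis of the second factor by \<open>r\<close> makes the two bases
    disjoint, and their union is again an initial segment.\<close>
  have "free_Abelian_group {..<s} \<cong> free_Abelian_group {r..<r+s}"
    by (subst isomorphic_free_Abelian_groups) (simp add: eqpoll_iff_card)
  then have "H \<cong> free_Abelian_group {r..<r+s}"
    using assms(4) iso_trans unfolding free_of_rank_def by blast
  then have "G \<times>\<times> H \<cong> free_Abelian_group {..<r} \<times>\<times> free_Abelian_group {r..<r+s}"
    using assms group.DirProd_iso_trans unfolding free_of_rank_def by blast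
  also have "\<dots> \<cong> free_Abelian_group ({..<r} \<union> {r..<r+s})"
    by (rule is_isoI, rule free_Abelian_group_Un_iso) auto
  also have "{..<r} \<union> {r..<r+s} = {..<r+s}" by auto
  finally show ?thesis by (simp add: free_of_rank_def)
qed

text \<open>Fraction-free Gaussian elimination, one coordinate per induction step. A vector
  \<open>y\<close> with nonzero coordinate \<open>r\<close> serves as pivot; if there is none,
  coordinate \<open>r\<close> imposes no condition.\<close>

lemma integer_vectors_dependent:
  fixes v :: "'a \<Rightarrow> nat \<Rightarrow> int"
  assumes "finite S" "card S > r"
  shows "\<exists>c. (\<exists>x\<in>S. c x \<noteq> 0) \<and> (\<forall>i<r. (\<Sum>x\<in>S. c x * v x i) = 0)"
  using assms
proof (induction r arbitrary: S v)
  case 0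
  then have "S \<noteq> {}" by auto
  then show ?case by (intro exI[of _ "\<lambda>_. 1"]) auto
next
  case (Suc r)
  show ?case
  proof (cases "\<forall>x\<in>S. v x r = 0")
    case True
    obtain c where "\<exists>x\<in>S. c x \<noteq> 0" "\<forall>i<r. (\<Sum>x\<in>S. c x * v x i) = 0"
      using Suc.IH[of S v] Suc.prems by auto
    with True show ?thesis
      by (intro exI[of _ c]) (auto simp: less_Suc_eq)
  next
    case False
    then obtain y where y: "y \<in> S" "v y r \<noteq> 0" by blast
    \<comment> \<open>Cross-multiplying with the pivot clears coordinate \<open>r\<close>, which
      leaves \<open>r\<close> coordinates for more than \<open>r\<close> vectors.\<close>
    define w where "w = (\<lambda>x i. v y r * v x i - v x r * v y i)"
    have "finite (S-{y})" "r < card (S-{y})"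
      using Suc.prems y(1) by auto
    from Suc.IH[OF this, of w]
    obtain c where c: "\<exists>x\<in>S-{y}. c x \<noteq> 0" "\<forall>i<r. (\<Sum>x\<in>S-{y}. c x * w x i) = 0"
      by (elim exE conjE)
    have cw: "(\<Sum>x\<in>S-{y}. c x * w x i) = 0" if "i < Suc r" for i
      using c(2) that by (cases "i = r") (auto simp: w_def less_Suc_eq)
    \<comment> \<open>Expanding \<open>w\<close> in the relation and collecting the multiples of
      \<open>v y\<close> gives these coefficients; the nonzero factor \<open>v y r\<close> keeps the
      relation nontrivial.\<close>
    define d where "d = (\<lambda>x. if x = y then - (\<Sum>x\<in>S-{y}. c x * v x r) else c x * v y r)"
    have "(\<Sum>x\<in>S. d x * v x i) = 0" if "i < Suc r" for i
    proof -
      have "(\<Sum>x\<in>S. d x * v x i) = d y * v y i + (\<Sum>x\<in>S-{y}. d x * v x i)"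
        using Suc.prems(1) y(1) by (simp add: sum.remove)
      also have "(\<Sum>x\<in>S-{y}. d x * v x i) = (\<Sum>x\<in>S-{y}. c x * v y r * v x i)"
        by (rule sum.cong) (auto simp: d_def)
      also have "d y * v y i = - (\<Sum>x\<in>S-{y}. c x * v x r * v y i)"
        by (simp add: d_def sum_distrib_right)
      also have "- (\<Sum>x\<in>S-{y}. c x * v x r * v y i) + (\<Sum>x\<in>S-{y}. c x * v y r * v x i)
          = (\<Sum>x\<in>S-{y}. c x * w x i)"
        by (simp add: w_def sum_subtractf algebra_simps)
      finally show ?thesis using cw[OF that] by simp
    qed
    moreover have "\<exists>x\<in>S. d x \<noteq> 0"
      using c(1) y(2) by (auto simp: d_def)
    ultimately show ?thesis by blast
  qed
qed

lemma hom_int_combination: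
  fixes f :: "'a \<Rightarrow> 'k \<Rightarrow>\<^sub>0 int" and c :: "'a \<Rightarrow> int"
  assumes "comm_group G" "f \<in> hom G (free_Abelian_group K)" "S \<subseteq> carrier G" "finite S"
  shows "f (finprod G (\<lambda>x. x [^]\<^bsub>G\<^esub> c x) S) = (\<Sum>x\<in>S. frag_cmul (c x) (f x))"
proof -
  interpret comm_group G by fact
  interpret f: group_hom G "free_Abelian_group K" f
    using assms(2) by (simp add: group_hom_def group_hom_axioms_def is_group)
  show ?thesis
    using assms(4,3)
  proof (induction S rule: finite_induct)
    case empty
    show ?case using f.hom_one by simp
  next
    case (insert x S)
    have "f (x [^]\<^bsub>G\<^esub> c x) = frag_cmul (c x) (f x)"
      using insert.prems f.hom_int_pow[of x "c x"] f.hom_closed[of x] by auto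
    moreover have "finprod G (\<lambda>x. x [^]\<^bsub>G\<^esub> c x) S \<in> carrier G"
      using insert.prems by (intro finprod_closed) auto
    ultimately show ?case
      using insert by (subst finprod_insert) (auto simp: f.hom_mult)
  qed
qed

text \<open>The coefficients of formal sums turn elements of \<open>G\<close> into integer vectors
  with \<open>r\<close> coordinates, so more than \<open>r\<close> elements satisfy a nontrivial
  relation; the preimages of the \<open>r\<close> generators are independent and attain the
  bound.\<close>

lemma group_rank_free_of_rank:
  assumes "comm_group G" "free_of_rank G r"
  shows "group_rank G = enat r"
proof -
  interpret comm_group G by fact
  obtain f where f: "f \<in> iso G (free_Abelian_group {..<r})"
    using assms(2) by (auto simp: free_of_rank_def is_iso_def)
  then have fh: "f \<in> hom G (free_Abelian_group {..<r})"
    and bij: "bij_betw f (carrier G) (carrier (free_Abelian_group {..<r}))"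
    by (auto simp: iso_def)
  interpret f: group_hom G "free_Abelian_group {..<r}" f
    using fh by (simp add: group_hom_def group_hom_axioms_def is_group)
  have one: "x = \<one>\<^bsub>G\<^esub>" if "x \<in> carrier G" "f x = 0" for x
    using that bij f.hom_one by (auto simp: bij_betw_def inj_on_def)
  have le: "card S \<le> r" if "int_independent G S" for S
  proof (rule ccontr)
    assume "\<not> card S \<le> r"
    moreover have S: "finite S" "S \<subseteq> carrier G"
      and ind: "\<And>c::_ \<Rightarrow> int. finprod G (\<lambda>x. x [^]\<^bsub>G\<^esub> c x) S = \<one>\<^bsub>G\<^esub> \<Longrightarrow> \<forall>x\<in>S. c x = 0"
      using that by (auto simp: int_independent_def)
    ultimately obtain c where c: "\<exists>x\<in>S. c x \<noteq> 0"
      "\<forall>i<r. (\<Sum>x\<in>S. c x * Poly_Mapping.lookup (f x) i) = 0"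
      using integer_vectors_dependent[of S r "\<lambda>x. Poly_Mapping.lookup (f x)"] by auto
    let ?y = "finprod G (\<lambda>x. x [^]\<^bsub>G\<^esub> c x) S"
    have y: "?y \<in> carrier G"
      using S by (intro finprod_closed) auto
    have "Poly_Mapping.lookup (f ?y) i = 0" for i
    proof (cases "i < r")
      case True
      then show ?thesis using c(2)
        by (simp add: hom_int_combination[OF assms(1) fh S(2,1)] lookup_sum)
    next
      case False
      then show ?thesis
        using f.hom_closed[OF y] by (auto simp: in_keys_iff)
    qed
    then have "f ?y = 0"
      by (intro poly_mapping_eqI) simp
    with one[OF y] ind c(1) show False by blast
  qed
  have "\<exists>S. int_independent G S \<and> card S = r"
  proof -
    define e where "e = (\<lambda>i. inv_into (carrier G) f (frag_of i))"
    have e: "e i \<in> carrier G" "f (e i) = frag_of i" if "i < r" for i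
    proof -
      have "frag_of i \<in> f ` carrier G"
        using bij that by (simp add: bij_betw_def)
      then show "e i \<in> carrier G" "f (e i) = frag_of i"
        unfolding e_def by (rule inv_into_into, rule f_inv_into_f)
    qed
    have inj: "inj_on e {..<r}"
    proof (rule inj_onI)
      fix i j assume "i \<in> {..<r}" "j \<in> {..<r}" "e i = e j"
      then have "frag_of i = frag_of j" using e(2) by (metis lessThan_iff)
      then show "i = j" by (simp add: frag_of_eq)
    qed
    have S: "e ` {..<r} \<subseteq> carrier G" using e(1) by auto
    have "\<forall>x\<in>e ` {..<r}. c x = 0"
      if "finprod G (\<lambda>x. x [^]\<^bsub>G\<^esub> c x) (e ` {..<r}) = \<one>\<^bsub>G\<^esub>" for c :: "_ \<Rightarrow> int"
    proof -
      have "0 = (\<Sum>x\<in>e ` {..<r}. frag_cmul (c x) (f x))"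
        using that f.hom_one by (simp flip: hom_int_combination[OF assms(1) fh S])
      also have "\<dots> = (\<Sum>i<r. frag_cmul (c (e i)) (frag_of i))"
        using inj by (simp add: sum.reindex e)
      finally have z: "(\<Sum>i<r. frag_cmul (c (e i)) (frag_of i)) = 0" by simp
      have "c (e j) = 0" if "j < r" for j
      proof -
        have "Poly_Mapping.lookup (\<Sum>i<r. frag_cmul (c (e i)) (frag_of i)) j
           = (\<Sum>i<r. if i = j then c (e i) else 0)"
          unfolding lookup_sum by (rule sum.cong) (auto simp: lookup_frag_of)
        with z that show ?thesis by simp
      qed
      then show ?thesis by auto
    qed
    then have "int_independent G (e ` {..<r})"
      using S by (simp add: int_independent_def)
    then show ?thesis using inj by (metis card_image card_lessThan)
  qed
  then obtain S where "int_independent G S" "card S = r" by blast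
  then show ?thesis
    unfolding group_rank_def using le
    by (intro antisym SUP_least) (auto intro: SUP_upper2)
qed

section \<open>Complements of sections of a trivial plane bundle\<close>

text \<open>Lets operations on numbers, whose continuity is expressed by
  \<open>continuous_on\<close>, act on continuous maps out of an abstract base topology.\<close>

lemma continuous_map_binary:
  fixes f :: "'a \<Rightarrow> 'b::topological_space" and g :: "'a \<Rightarrow> 'c::topological_space"
    and h :: "'b \<Rightarrow> 'c \<Rightarrow> 'd::topological_space"
  assumes "continuous_map X euclidean f" "continuous_map X euclidean g"
    and "continuous_on UNIV (\<lambda>z. h (fst z) (snd z))"
  shows "continuous_map X euclidean (\<lambda>x. h (f x) (g x))"
proof -
  have "continuous_map X euclidean (\<lambda>x. (f x, g x))"
    using assms(1,2) continuous_map_pairedI[of X euclidean f euclidean g]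
    by (simp add: euclidean_product_topology)
  then have "continuous_map X euclidean ((\<lambda>z. h (fst z) (snd z)) \<circ> (\<lambda>x. (f x, g x)))"
    using assms(3) by (intro continuous_map_compose[where X'=euclidean]) auto
  then show ?thesis
    by (simp add: o_def)
qed

section \<open>Products with a contractible factor\<close>

lemma homotopic_prod_contractible:
  assumes "contractible S" "a \<in> S"
  shows "homotopic_with (\<lambda>h. True) (prod_topology B (top_of_set S)) (prod_topology B (top_of_set S))
           (\<lambda>z. (fst z, a)) id"
proof -
  have "homotopic_with (\<lambda>h. True) (top_of_set S) (top_of_set S) (\<lambda>x. a) id"
    using assms by (metis contractible_space_alt contractible_space_top_of_set
        homotopic_with_sym topspace_euclidean_subtopology)
  from homotopic_with_prod_topology[OF _ this, of "\<lambda>h. True" B B id id "\<lambda>h. True"]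
  show ?thesis
    by (simp add: id_def)
qed

lemma homology_group_prod_contractible:
  assumes "contractible S" "S \<noteq> {}"
  shows "homology_group p (prod_topology B (top_of_set S)) \<cong> homology_group p B"
proof -
  obtain a where a: "a \<in> S" using assms by auto
  show ?thesis
  proof (rule deformation_retraction_imp_isomorphic_homology_groups)
    show "retraction_maps (prod_topology B (top_of_set S)) B fst (\<lambda>b. (b, a))"
      using a by (auto simp: retraction_maps_def continuous_map_fst continuous_map_paired)
    show "homotopic_with (\<lambda>h. True) (prod_topology B (top_of_set S)) (prod_topology B (top_of_set S))
       ((\<lambda>b. (b, a)) \<circ> fst) id"
      using homotopic_prod_contractible[OF assms(1) a] by (simp add: o_def)
  qed
qed

lemma subtopology_prod_top_of_set:
  assumes "T \<subseteq> S"
  shows "subtopology (prod_topology B (top_of_set S)) (topspace B \<times> T) = prod_topology B (top_of_set T)"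
  using assms by (simp flip: prod_topology_subtopology add: subtopology_subtopology Int_absorb1)

text \<open>Collapsing the second factor to a point of \<open>T\<close> is homotopic to the identity
  on the big space as well as on the subspace, so the pair has no relative homology.\<close>

lemma trivial_relative_homology_group_prod_contractible:
  assumes "contractible S" "contractible T" "T \<subseteq> S" "T \<noteq> {}"
  shows "trivial_group (relative_homology_group p (prod_topology B (top_of_set S)) (topspace B \<times> T))"
proof -
  obtain a where a: "a \<in> T" using assms by auto
  show ?thesis
  proof (rule trivial_relative_homology_group_gen)
    show "continuous_map (prod_topology B (top_of_set S))
       (subtopology (prod_topology B (top_of_set S)) (topspace B \<times> T)) (\<lambda>z. (fst z, a))"
      using a assms(3) by (auto simp: subtopology_prod_top_of_set continuous_map_paired continuous_map_fst)
    show "homotopic_with (\<lambda>h. True)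
        (subtopology (prod_topology B (top_of_set S)) (topspace B \<times> T))
        (subtopology (prod_topology B (top_of_set S)) (topspace B \<times> T)) (\<lambda>z. (fst z, a)) id"
      using homotopic_prod_contractible[OF assms(2) a] assms(3) by (simp add: subtopology_prod_top_of_set)
    show "homotopic_with (\<lambda>h. True) (prod_topology B (top_of_set S)) (prod_topology B (top_of_set S))
       (\<lambda>z. (fst z, a)) id"
      using homotopic_prod_contractible[OF assms(1)] a assms(3) by blast
  qed
qed

section \<open>Exact sequences and excision for relative homology\<close>

lemma relative_homology_group_boundary_iso:
  assumes "T \<subseteq> S" and triv: "\<And>q. trivial_group (relative_homology_group q X T)"
  shows "relative_homology_group p X S \<cong> relative_homology_group (p - 1) (subtopology X S) T"
proof -
  \<comment> \<open>In the long exact sequence of the triple (X, S, T) the connecting homomorphism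
    stands between two vanishing groups.\<close>
  have "hom_relboundary p X S T \<in> iso (relative_homology_group p X S)
           (relative_homology_group (p - 1) (subtopology X S) T)"
  proof (rule very_short_exact_sequence)
    show "exact_seq ([relative_homology_group (p-1) X T,
                      relative_homology_group (p-1) (subtopology X S) T,
                      relative_homology_group p X S, relative_homology_group p X T],
             [hom_induced (p-1) (subtopology X S) T X T id, hom_relboundary p X S T,
              hom_induced p X T X S id])"
      using homology_exactness_triple_1[OF assms(1), of p X] homology_exactness_triple_2[OF assms(1), of p X]
      by simp
  qed (use triv in auto)
  then show ?thesis
    by (auto simp: is_iso_def)
qed

text \<open>The excised set is the complement of \<open>S\<close>: it is closed, and the covering
  condition places it inside the open set \<open>T\<close>.\<close>

lemma relative_homology_group_excision_iso:
  assumes "openin X S" "openin X T" "S \<union> T = topspace X"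
  shows "hom_induced p (subtopology X S) (S \<inter> T) X T id
    \<in> iso (relative_homology_group p (subtopology X S) (S \<inter> T)) (relative_homology_group p X T)"
proof -
  define U where "U = topspace X - S"
  have U: "topspace X - U = S" "T - U = S \<inter> T"
    using assms openin_subset[of X S] openin_subset[of X T] by (auto simp: U_def)
  have "X closure_of U \<subseteq> X interior_of T"
  proof -
    have "closedin X U" using assms(1) by (auto simp: U_def)
    moreover have "U \<subseteq> T" using assms(3) by (auto simp: U_def)
    ultimately show ?thesis using assms(2) by (simp add: closure_of_closedin interior_of_openin)
  qed
  from homology_excision_axiom[OF this, of "topspace X" p] openin_subset[OF assms(2)]
  show ?thesis
    by (simp add: U)
qed

text \<open>Relative Mayer-Vietoris for an open cover. The homology of each of the pairs (S, S
  \<inter> T) and (T, S \<inter> T) maps into that of (X, S \<inter> T); from there it goes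
  isomorphically onto one factor by excision and to zero in the other by exactness, which splits the
  group.\<close>

lemma relative_homology_group_Int:
  assumes "openin X S" "openin X T" "S \<union> T = topspace X"
  shows "relative_homology_group p X (S \<inter> T)
         \<cong> relative_homology_group p X S \<times>\<times> relative_homology_group p X T"
proof -
  have "(\<lambda>z. (hom_induced p X (S \<inter> T) X S id z, hom_induced p X (S \<inter> T) X T id z))
     \<in> iso (relative_homology_group p X (S \<inter> T))
           (relative_homology_group p X S \<times>\<times> relative_homology_group p X T)"
  proof (rule conjunct2[OF exact_sequence_sum_lemma])
    have TS: "T \<union> S = topspace X" "T \<inter> S = S \<inter> T"
      using assms(3) by auto
    show "hom_induced p (subtopology X S) (S \<inter> T) X T id
      \<in> iso (relative_homology_group p (subtopology X S) (S \<inter> T)) (relative_homology_group p X T)"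
      by (rule relative_homology_group_excision_iso[OF assms])
    show "hom_induced p (subtopology X T) (S \<inter> T) X S id
      \<in> iso (relative_homology_group p (subtopology X T) (S \<inter> T)) (relative_homology_group p X S)"
      using relative_homology_group_excision_iso[OF assms(2,1) TS(1), of p] by (simp add: TS(2))
    show "exact_seq ([relative_homology_group p X T, relative_homology_group p X (S \<inter> T),
             relative_homology_group p (subtopology X T) (S \<inter> T)],
           [hom_induced p X (S \<inter> T) X T id, hom_induced p (subtopology X T) (S \<inter> T) X (S \<inter> T) id])"
      by (rule homology_exactness_triple_3) auto
    show "exact_seq ([relative_homology_group p X S, relative_homology_group p X (S \<inter> T),
             relative_homology_group p (subtopology X S) (S \<inter> T)],
           [hom_induced p X (S \<inter> T) X S id, hom_induced p (subtopology X S) (S \<inter> T) X (S \<inter> T) id])"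
      by (rule homology_exactness_triple_3) auto
  qed (auto simp: hom_induced_compose')
  then show ?thesis
    by (auto simp: is_iso_def)
qed

text \<open>Each step splits off a contractible piece: the plane is cut along the two real half-lines,
  and two connecting homomorphisms followed by excisions lead down to a half-plane.\<close>
lemma relative_homology_group_prod_punctured_plane:
  "relative_homology_group p (prod_topology B euclidean) (topspace B \<times> (- {0::complex}))
   \<cong> homology_group (p - 2) B"
proof -
  \<comment> \<open>\<open>P\<close> and \<open>N\<close> are the planes slit along the nonpositive
    and the nonnegative reals. They cover the punctured plane and meet in the two disjoint
    half-planes \<open>U\<close> and \<open>L\<close>; all four are contractible.\<close>
  define P N U L :: "complex set" where "P = - complex_of_real ` {..0}"
    and "N = - complex_of_real ` {0..}" and "U = {z. Im z > 0}" and "L = {z. Im z < 0}"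
  have P: "P = {z. Re z > 0 \<or> Im z \<noteq> 0}" and N: "N = {z. Re z < 0 \<or> Im z \<noteq> 0}"
    by (auto simp: P_def N_def image_iff complex_eq_iff not_le)
  have sets: "P \<union> N = -{0}" "P \<inter> N = U \<union> L" "U \<inter> L = {}" "U \<subseteq> N"
    by (auto simp: P N U_def L_def complex_eq_iff)
  have op: "open P" "open N" "open U" "open L"
  proof -
    show "open U" "open L"
      by (auto simp: U_def L_def intro!: open_Collect_less continuous_intros)
    have "P = {z. 0 < Re z} \<union> U \<union> L" "N = {z. Re z < 0} \<union> U \<union> L"
      by (auto simp: P N U_def L_def)
    with \<open>open U\<close> \<open>open L\<close> show "open P" "open N"
      by (auto intro!: open_Un open_Collect_less continuous_intros)
  qed
  have con: "contractible P" "contractible N" "contractible U" "contractible L"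
  proof -
    show "contractible P" unfolding P_def
      by (intro starlike_imp_contractible starlike_slotted_complex_plane_left)
    show "contractible N" unfolding N_def
      by (intro starlike_imp_contractible starlike_slotted_complex_plane_right)
    show "contractible U" "contractible L" unfolding U_def L_def
      by (intro convex_imp_contractible convex_halfspace_Im_gt convex_halfspace_Im_lt)+
  qed
  have "\<i> \<in> U" "-\<i> \<in> L" "1 \<in> P"
    by (auto simp: U_def L_def P)
  then have ne: "U \<noteq> {}" "L \<noteq> {}" "P \<noteq> {}" by auto
  define W where "W = (\<lambda>S::complex set. prod_topology B (top_of_set S))"
  define b where "b = topspace B"
  have W: "subtopology (W S) (b \<times> T) = W T" if "T \<subseteq> S" for S T
    using subtopology_prod_top_of_set[OF that] by (simp add: W_def b_def)
  have opW: "openin (W S) (b \<times> T)" if "T \<subseteq> S" "open T" for S T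
    using that by (auto simp: W_def b_def openin_prod_Times_iff intro: open_subset)
  have topW: "topspace (W S) = b \<times> S" for S
    by (simp add: W_def b_def)
  have "relative_homology_group p (W UNIV) (b \<times> (-{0})) \<cong> relative_homology_group (p-1) (W (-{0})) (b \<times> P)"
  proof -
    have "relative_homology_group p (W UNIV) (b \<times> (-{0})) \<cong>
          relative_homology_group (p-1) (subtopology (W UNIV) (b \<times> (-{0}))) (b \<times> P)"
    proof (rule relative_homology_group_boundary_iso)
      show "trivial_group (relative_homology_group q (W UNIV) (b \<times> P))" for q
        unfolding W_def b_def
        by (rule trivial_relative_homology_group_prod_contractible) (use con ne in auto)
    qed (use sets in auto)
    then show ?thesis
      by (simp add: W)
  qed
  also have "\<dots> \<cong> relative_homology_group (p-1) (W N) (b \<times> (N \<inter> P))"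
  proof -
    have "hom_induced (p-1) (subtopology (W (-{0})) (b \<times> N)) (b \<times> N \<inter> b \<times> P) (W (-{0})) (b \<times> P) id
       \<in> iso (relative_homology_group (p-1) (subtopology (W (-{0})) (b \<times> N)) (b \<times> N \<inter> b \<times> P))
         (relative_homology_group (p-1) (W (-{0})) (b \<times> P))"
      using sets op by (intro relative_homology_group_excision_iso opW) (auto simp: topW)
    moreover have "subtopology (W (-{0})) (b \<times> N) = W N" "b \<times> N \<inter> b \<times> P = b \<times> (N \<inter> P)"
      using sets by (auto intro!: W)
    ultimately show ?thesis
      by (metis group.iso_sym group_relative_homology_group is_isoI)
  qed
  also have "\<dots> \<cong> relative_homology_group (p-2) (W (N \<inter> P)) (b \<times> U)"
  proof -
    have "relative_homology_group (p-1) (W N) (b \<times> (N \<inter> P)) \<cong>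
          relative_homology_group (p-1-1) (subtopology (W N) (b \<times> (N \<inter> P))) (b \<times> U)"
    proof (rule relative_homology_group_boundary_iso)
      show "trivial_group (relative_homology_group q (W N) (b \<times> U))" for q
        unfolding W_def b_def
        by (rule trivial_relative_homology_group_prod_contractible) (use con ne sets in auto)
    qed (use sets in auto)
    then show ?thesis
      using sets by (simp add: W)
  qed
  also have "\<dots> \<cong> homology_group (p-2) (W L)"
  proof -
    \<comment> \<open>Excising \<open>U\<close> from the disjoint union of the half-planes leaves
      \<open>L\<close> relative to the empty set, which is absolute homology.\<close>
    have "hom_induced (p-2) (subtopology (W (N \<inter> P)) (b \<times> L)) (b \<times> L \<inter> b \<times> U) (W (N \<inter> P)) (b \<times> U) id
       \<in> iso (relative_homology_group (p-2) (subtopology (W (N \<inter> P)) (b \<times> L)) (b \<times> L \<inter> b \<times> U))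
         (relative_homology_group (p-2) (W (N \<inter> P)) (b \<times> U))"
      using sets op by (intro relative_homology_group_excision_iso opW) (auto simp: topW)
    moreover have "subtopology (W (N \<inter> P)) (b \<times> L) = W L" "b \<times> L \<inter> b \<times> U = {}"
      using sets by (auto intro!: W)
    ultimately show ?thesis
      by (metis group.iso_sym group_relative_homology_group is_isoI)
  qed
  also have "\<dots> \<cong> homology_group (p-2) B"
    unfolding W_def using con ne by (intro homology_group_prod_contractible)
  finally show ?thesis
    by (simp add: W_def b_def)
qed

section \<open>Removing finitely many disjoint sections from a trivial plane bundle\<close>

lemma continuous_map_sum_euclidean:
  fixes f :: "'i \<Rightarrow> 'a \<Rightarrow> 'b::{topological_comm_monoid_add}"
  assumes "finite I" "\<And>i. i \<in> I \<Longrightarrow> continuous_map X euclidean (f i)"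
  shows "continuous_map X euclidean (\<lambda>x. \<Sum>i\<in>I. f i x)"
  using assms
proof (induction I rule: finite_induct)
  case (insert i I)
  then have "continuous_map X euclidean (\<lambda>x. f i x + (\<Sum>i\<in>I. f i x))"
    by (intro continuous_map_binary[where h="(+)"] continuous_on_add continuous_on_fst continuous_on_snd
        continuous_on_id) auto
  with insert show ?case by simp
qed simp

text \<open>A set of pairs over a fixed base, so that removing further sections is intersection with
  another set of the same form.\<close>

definition punctured_bundle :: "'b topology \<Rightarrow> ('i \<Rightarrow> 'b \<Rightarrow> complex) \<Rightarrow> 'i set \<Rightarrow> ('b \<times> complex) set" where
  "punctured_bundle B a I = {z. fst z \<in> topspace B \<and> (\<forall>i\<in>I. snd z \<noteq> a i (fst z))}"

text \<open>Openness is what excision asks for. Off the section \<open>a i\<close> the difference of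
  the fibre coordinate and \<open>a i\<close> is nonzero, an open condition.\<close>

lemma openin_punctured_bundle:
  assumes "finite I" "\<And>i. i \<in> I \<Longrightarrow> continuous_map B euclidean (a i)"
  shows "openin (prod_topology B euclidean) (punctured_bundle B a I)"
proof -
  let ?T = "prod_topology B (euclidean :: complex topology)"
  have op: "openin ?T {z \<in> topspace ?T. snd z - a i (fst z) \<in> - {0}}" if "i \<in> I" for i
  proof (rule openin_continuous_map_preimage)
    show "continuous_map ?T euclidean (\<lambda>z. snd z - a i (fst z))"
      by (rule continuous_map_binary[OF continuous_map_snd
            continuous_map_compose[OF continuous_map_fst assms(2)[OF that], unfolded o_def]])
        (intro continuous_intros)
  qed auto
  have "punctured_bundle B a I = topspace ?T \<inter> (\<Inter>i\<in>I. {z \<in> topspace ?T. snd z - a i (fst z) \<in> - {0}})"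
    by (auto simp: punctured_bundle_def)
  also have "openin ?T \<dots>"
  \<comment> \<open>For empty \<open>I\<close> the intersection over \<open>I\<close> is
    \<open>UNIV\<close>, which need not be open in the product; meeting it with the topspace repairs
    this.\<close>
  proof (cases "I = {}")
    case False
    with op assms(1) show ?thesis by (intro openin_Int openin_topspace openin_Inter) auto
  qed (simp add: openin_prod_Times_iff)
  finally show ?thesis .
qed

lemma relative_homology_group_punctured_bundle_singleton:
  assumes "continuous_map B euclidean (a i)"
  shows "relative_homology_group p (prod_topology B euclidean) (punctured_bundle B a {i})
    \<cong> homology_group (p - 2) B"
proof -
  let ?T = "prod_topology B (euclidean :: complex topology)"
  \<comment> \<open>a fibrewise translation moves the puncture to the origin\<close>
  let ?f = "\<lambda>z. (fst z, snd z - a i (fst z))" and ?g = "\<lambda>z. (fst z, snd z + a i (fst z))"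
  have cont: "continuous_map ?T ?T (\<lambda>z. (fst z, h (snd z) (a i (fst z))))"
    if "continuous_on UNIV (\<lambda>z. h (fst z) (snd z))" for h
    using continuous_map_compose[OF continuous_map_fst assms, unfolded o_def] that
    by (intro continuous_map_pairedI continuous_map_binary[where h=h] continuous_map_snd continuous_map_fst)
  have "homeomorphic_maps ?T ?T ?f ?g"
    unfolding homeomorphic_maps_def
    by (intro conjI cont continuous_intros) auto
  then have "hom_induced p ?T (punctured_bundle B a {i}) ?T (topspace B \<times> (-{0})) ?f
     \<in> iso (relative_homology_group p ?T (punctured_bundle B a {i}))
           (relative_homology_group p ?T (topspace B \<times> (-{0})))"
    by (intro group_isomorphisms_imp_iso[OF homeomorphic_maps_relative_homology_group_isomorphisms])
       (auto simp: punctured_bundle_def)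
  then show ?thesis
    by (rule iso_trans[OF is_isoI relative_homology_group_prod_punctured_plane])
qed

text \<open>Induction on the sections. By disjointness the complement of one section and the
  complement of the others cover the total space, so the relative group of their intersection
  splits, and each section contributes one copy of degree \<open>p - 2\<close> of the base.\<close>

lemma free_of_rank_relative_punctured_bundle:
  assumes "finite I" "\<And>i. i \<in> I \<Longrightarrow> continuous_map B euclidean (a i)"
    and "\<And>i j b. \<lbrakk>i \<in> I; j \<in> I; i \<noteq> j; b \<in> topspace B\<rbrakk> \<Longrightarrow> a i b \<noteq> a j b"
    and "free_of_rank (homology_group (p - 2) B) s"
  shows "free_of_rank (relative_homology_group p (prod_topology B euclidean) (punctured_bundle B a I)) (card I * s)"
  using assms(1-3)
proof (induction I rule: finite_induct)
  case empty
  have "punctured_bundle B a {} = topspace (prod_topology B euclidean)"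
    by (auto simp: punctured_bundle_def)
  then show ?case
    by (simp only: card.empty mult_0)
      (intro free_of_rank_trivial group_relative_homology_group trivial_relative_homology_group_topspace)
next
  case (insert i I)
  let ?H = "\<lambda>J. relative_homology_group p (prod_topology B euclidean) (punctured_bundle B a J)"
  have "?H (insert i I) = relative_homology_group p (prod_topology B euclidean)
     (punctured_bundle B a {i} \<inter> punctured_bundle B a I)"
    by (rule arg_cong) (auto simp: punctured_bundle_def)
  also have "\<dots> \<cong> ?H {i} \<times>\<times> ?H I"
  proof (rule relative_homology_group_Int)
    show "openin (prod_topology B euclidean) (punctured_bundle B a {i})"
      "openin (prod_topology B euclidean) (punctured_bundle B a I)"
      using insert by (auto intro!: openin_punctured_bundle)
    show "punctured_bundle B a {i} \<union> punctured_bundle B a I = topspace (prod_topology B euclidean)"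
      using insert.prems(2) insert.hyps(2) by (fastforce simp: punctured_bundle_def)
  qed
  finally have "?H (insert i I) \<cong> ?H {i} \<times>\<times> ?H I" .
  moreover have "free_of_rank (?H {i}) s"
    using insert.prems(1) assms(4)
    by (intro free_of_rank_iso[OF relative_homology_group_punctured_bundle_singleton]) auto
  moreover have "free_of_rank (?H I) (card I * s)"
    using insert by auto
  ultimately have "free_of_rank (?H (insert i I)) (s + card I * s)"
    by (rule free_of_rank_iso[OF _ free_of_rank_DirProd[OF group_relative_homology_group group_relative_homology_group]])
  then show ?case using insert.hyps by simp
qed

lemma free_of_rank_punctured_bundle:
  assumes "finite I" "\<And>i. i \<in> I \<Longrightarrow> continuous_map B euclidean (a i)"
    and "\<And>i j b. \<lbrakk>i \<in> I; j \<in> I; i \<noteq> j; b \<in> topspace B\<rbrakk> \<Longrightarrow> a i b \<noteq> a j b"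
    and "free_of_rank (homology_group p B) r" "free_of_rank (homology_group (p - 1) B) s"
  shows "free_of_rank (homology_group p (subtopology (prod_topology B euclidean) (punctured_bundle B a I)))
    (r + card I * s)"
proof -
  let ?T = "prod_topology B (euclidean :: complex topology)"
  \<comment> \<open>a section that avoids all punctures, so that the inclusion of the bundle splits in homology\<close>
  define R where "R = (\<lambda>b. complex_of_real (1 + (\<Sum>i\<in>I. norm (a i b))))"
  have R: "R b \<noteq> a i b" if "i \<in> I" for i b
  proof
    assume "R b = a i b"
    moreover have "norm (R b) = 1 + (\<Sum>i\<in>I. norm (a i b))"
      unfolding R_def norm_of_real by (simp add: add_nonneg_nonneg sum_nonneg)
    moreover have "norm (a i b) \<le> (\<Sum>i\<in>I. norm (a i b))"
      using that assms(1) by (intro member_le_sum) auto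
    ultimately show False by simp
  qed
  have Rc: "continuous_map B euclidean R"
  proof -
    have "continuous_map B euclidean (\<lambda>b. norm (a i b))" if "i \<in> I" for i
      using continuous_map_compose[OF assms(2)[OF that], of euclidean norm]
      by (simp add: o_def continuous_on_norm continuous_on_id)
    then have "continuous_map B euclidean (\<lambda>b. \<Sum>i\<in>I. norm (a i b))"
      by (intro continuous_map_sum_euclidean assms(1))
    moreover have "continuous_map euclidean euclidean (\<lambda>x. complex_of_real (1 + x))"
      by (simp, intro continuous_intros)
    ultimately show ?thesis
      unfolding R_def by (rule continuous_map_compose[unfolded o_def])
  qed
  \<comment> \<open>Straight-line homotopy in each fibre, from the identity to the projection onto
    the section \<open>R\<close>.\<close>
  have hom: "homotopic_with (\<lambda>x. True) ?T ?T id (\<lambda>z. (fst z, R (fst z)))"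
  proof -
    let ?h = "\<lambda>w. (fst (snd w), snd (snd w) + of_real (fst w) * (R (fst (snd w)) - snd (snd w)))"
    let ?IT = "prod_topology (top_of_set {0..1::real}) ?T"
    have fst: "continuous_map ?IT B (\<lambda>w. fst (snd w))"
      by (rule continuous_map_compose[OF continuous_map_snd continuous_map_fst, unfolded o_def])
    have snd: "continuous_map ?IT euclidean (\<lambda>w. snd (snd w))"
      by (rule continuous_map_compose[OF continuous_map_snd continuous_map_snd, unfolded o_def])
    have t: "continuous_map ?IT euclidean (\<lambda>w. fst w)"
      by (intro continuous_map_into_fulltopology[OF continuous_map_fst])
    have r: "continuous_map ?IT euclidean (\<lambda>w. R (fst (snd w)))"
      by (rule continuous_map_compose[OF fst Rc, unfolded o_def])
    have "continuous_map ?IT euclidean (\<lambda>w. R (fst (snd w)) - snd (snd w))"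
      by (rule continuous_map_binary[where h="(-)", OF r snd]) (intro continuous_intros)
    then have "continuous_map ?IT euclidean (\<lambda>w. of_real (fst w) * (R (fst (snd w)) - snd (snd w)))"
      by (rule continuous_map_binary[where h="\<lambda>t x. of_real t * x", OF t]) (intro continuous_intros)
    then have "continuous_map ?IT euclidean (\<lambda>w. snd (snd w) + of_real (fst w) * (R (fst (snd w)) - snd (snd w)))"
      by (rule continuous_map_binary[where h="(+)", OF snd]) (intro continuous_intros)
    then have "continuous_map ?IT ?T ?h"
      by (intro continuous_map_pairedI fst)
    then show ?thesis
      unfolding homotopic_with_def by (intro exI[of _ ?h]) auto
  qed
  \<comment> \<open>As the identity deforms into the punctured bundle, the inclusion of the bundle
    is a split surjection in homology; its kernel is the relative group one degree higher.\<close>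
  have "homology_group p (subtopology ?T (punctured_bundle B a I))
     \<cong> homology_group p ?T \<times>\<times> relative_homology_group (p + 1) ?T (punctured_bundle B a I)"
  proof (rule iso_homology_group_prod_deformation[OF hom])
    show "(\<lambda>z. (fst z, R (fst z))) \<in> topspace ?T \<rightarrow> punctured_bundle B a I"
      using R by (auto simp: punctured_bundle_def)
  qed
  moreover have "free_of_rank (homology_group p ?T) r"
    using homology_group_prod_contractible[of "UNIV :: complex set" p B] assms(4)
    by (intro free_of_rank_iso[of "homology_group p ?T"]) auto
  \<comment> \<open>In degree \<open>p + 1\<close> each section contributes degree
    \<open>p + 1 - 2 = p - 1\<close> of the base, the group of rank \<open>s\<close>.\<close>
  moreover have "free_of_rank (relative_homology_group (p + 1) ?T (punctured_bundle B a I)) (card I * s)"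
    using assms by (intro free_of_rank_relative_punctured_bundle) auto
  ultimately show ?thesis
    by (rule free_of_rank_iso[OF _ free_of_rank_DirProd[OF group_relative_homology_group group_relative_homology_group]])
qed

section \<open>The projective line\<close>

abbreviation proj_pt :: "complex^2 \<Rightarrow> (complex^2) set" where
  "proj_pt v \<equiv> proj_rel `` {v}"

text \<open>The determinant with columns \<open>v\<close> and \<open>w\<close>; it vanishes exactly
  when the vectors are linearly dependent and so decides equality of projective points.\<close>

definition cross2 :: "complex^2 \<Rightarrow> complex^2 \<Rightarrow> complex" where
  "cross2 v w = v$1 * w$2 - v$2 * w$1"

lemma mem_proj_pt: "w \<in> proj_pt v \<longleftrightarrow> v \<noteq> 0 \<and> w \<noteq> 0 \<and> (\<exists>c. c \<noteq> 0 \<and> w = c *s v)"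
  by (auto simp: proj_rel_def)

lemma proj_pt_self: "v \<noteq> 0 \<Longrightarrow> v \<in> proj_pt v"
  by (auto simp: proj_rel_def intro!: exI[of _ 1])

lemma proj_line_cases:
  assumes "p \<in> proj_line"
  obtains v where "v \<noteq> 0" "p = proj_pt v"
  using assms by (auto simp: proj_line_def quotient_def)

lemma proj_pt_in_proj_line: "v \<noteq> 0 \<Longrightarrow> proj_pt v \<in> proj_line"
  by (auto simp: proj_line_def quotient_def)

lemma proj_pt_scale:
  assumes "c \<noteq> 0"
  shows "proj_pt (c *s v) = proj_pt v"
proof -
  have sub: "proj_pt (d *s u) \<subseteq> proj_pt u" if "d \<noteq> 0" for d u
  proof
    fix w assume "w \<in> proj_pt (d *s u)"
    then obtain e where "d *s u \<noteq> 0" "w \<noteq> 0" "e \<noteq> 0" "w = (e * d) *s u"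
      by (auto simp only: mem_proj_pt vector_smult_assoc)
    then show "w \<in> proj_pt u"
      using that unfolding mem_proj_pt by (metis mult_eq_0_iff vector_mul_eq_0)
  qed
  have "inverse c *s (c *s v) = v"
    using assms by (simp add: vector_smult_assoc)
  then show ?thesis
    using sub[OF assms, of v] sub[of "inverse c" "c *s v"] assms by auto
qed

text \<open>Cramer's rule cleared of denominators: \<open>u\<close> expanded in \<open>v\<close> and
  \<open>w\<close>.\<close>

lemma cross2_cramer: "cross2 v w *s u = cross2 u w *s v + cross2 v u *s w"
  by (simp add: vec_eq_iff forall_2 cross2_def algebra_simps)

lemma cross2_simps:
  "cross2 (c *s v) w = c * cross2 v w" "cross2 v (c *s w) = c * cross2 v w"
  "cross2 (v + v') w = cross2 v w + cross2 v' w" "cross2 v (w + w') = cross2 v w + cross2 v w'"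
  "cross2 v v = 0"
  by (simp_all add: cross2_def algebra_simps)

text \<open>A second basis vector given by a formula: the Hermitian orthogonal of \<open>v\<close>,
  normalised so that its determinant with \<open>v\<close> is the squared length of
  \<open>v\<close>.\<close>

definition perp :: "complex^2 \<Rightarrow> complex^2" where
  "perp v = (\<chi> i. if i = 1 then - cnj (v$2) else cnj (v$1))"

lemma cross2_perp: "v \<noteq> 0 \<Longrightarrow> cross2 v (perp v) \<noteq> 0"
proof -
  assume "v \<noteq> 0"
  then have "v$1 \<noteq> 0 \<or> v$2 \<noteq> 0"
    by (simp add: vec_eq_iff forall_2)
  moreover have "cross2 v (perp v) = of_real ((norm (v$1))\<^sup>2 + (norm (v$2))\<^sup>2)"
    by (simp only: of_real_add complex_norm_square) (simp add: cross2_def perp_def)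
  ultimately show ?thesis
    by (simp only: of_real_eq_0_iff) (auto simp: add_nonneg_eq_0_iff)
qed

lemma proj_pt_eq_iff:
  assumes "v \<noteq> 0" "w \<noteq> 0"
  shows "proj_pt v = proj_pt w \<longleftrightarrow> cross2 v w = 0"
proof
  assume "proj_pt v = proj_pt w"
  moreover have "w \<in> proj_pt w"
    by (rule proj_pt_self[OF assms(2)])
  ultimately obtain c where "w = c *s v"
    by (metis mem_proj_pt)
  then show "cross2 v w = 0"
    by (simp add: cross2_simps)
next
  assume "cross2 v w = 0"
  \<comment> \<open>Cramer's rule in the basis \<open>v\<close>, \<open>perp v\<close>: the
    coefficient of \<open>perp v\<close> is the vanishing determinant.\<close>
  then have e: "cross2 v (perp v) *s w = cross2 w (perp v) *s v"
    using cross2_cramer[of v "perp v" w] by simp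
  have n: "cross2 v (perp v) \<noteq> 0"
    by (rule cross2_perp[OF assms(1)])
  have "cross2 w (perp v) \<noteq> 0"
  proof
    assume "cross2 w (perp v) = 0"
    with e n assms(2) show False by (simp add: vector_mul_eq_0)
  qed
  with e n show "proj_pt v = proj_pt w"
    by (metis proj_pt_scale)
qed

text \<open>The affine coordinate with \<open>proj_pt u\<close> at infinity: \<open>v\<close> is
  proportional to \<open>t *s u + perp u\<close> with \<open>t\<close> this ratio. The ratio is
  homogeneous of degree 0, hence independent of the representative picked by \<open>SOME\<close>; at
  \<open>proj_pt u\<close> division by zero gives 0.\<close>

definition chart :: "complex^2 \<Rightarrow> (complex^2) set \<Rightarrow> complex" where
  "chart u p = (let v = SOME v. v \<in> p in cross2 v (perp u) / cross2 u v)"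

definition chart_inv :: "complex^2 \<Rightarrow> complex \<Rightarrow> (complex^2) set" where
  "chart_inv u t = proj_pt (t *s u + perp u)"

lemma chart_proj_pt:
  assumes "v \<noteq> 0"
  shows "chart u (proj_pt v) = cross2 v (perp u) / cross2 u v"
proof -
  have "v \<in> proj_pt v"
    by (rule proj_pt_self[OF assms])
  then have "(SOME w. w \<in> proj_pt v) \<in> proj_pt v"
    by (rule someI)
  then obtain c where "c \<noteq> 0" "(SOME w. w \<in> proj_pt v) = c *s v"
    unfolding mem_proj_pt by blast
  then show ?thesis
    by (simp add: chart_def cross2_simps)
qed

lemma chart_inv_vector_nonzero:
  assumes "u \<noteq> 0"
  shows "t *s u + perp u \<noteq> 0"
proof
  assume "t *s u + perp u = 0"
  then have "cross2 u (t *s u + perp u) = 0" by (simp add: cross2_def)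
  with cross2_perp[OF assms] show False by (simp add: cross2_simps)
qed

lemma chart_chart_inv:
  assumes "u \<noteq> 0"
  shows "chart u (chart_inv u t) = t"
  unfolding chart_inv_def chart_proj_pt[OF chart_inv_vector_nonzero[OF assms]]
  using cross2_perp[OF assms] by (simp add: cross2_simps)

lemma chart_inv_in:
  assumes "u \<noteq> 0"
  shows "chart_inv u t \<in> proj_line - {proj_pt u}"
  using proj_pt_in_proj_line[OF chart_inv_vector_nonzero[OF assms]] cross2_perp[OF assms]
    proj_pt_eq_iff[OF assms chart_inv_vector_nonzero[OF assms]]
  by (auto simp: chart_inv_def cross2_simps)

lemma chart_inv_chart:
  assumes "u \<noteq> 0" "p \<in> proj_line - {proj_pt u}"
  shows "chart_inv u (chart u p) = p"
proof -
  obtain v where v: "v \<noteq> 0" "p = proj_pt v"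
    using assms(2) by (auto elim: proj_line_cases)
  have n: "cross2 u v \<noteq> 0"
    using assms v proj_pt_eq_iff[of u v] by auto
  have "cross2 u v *s (chart u p *s u + perp u) = cross2 u (perp u) *s v"
    using n cross2_cramer[of u "perp u" v]
    by (simp add: v chart_proj_pt vector_add_ldistrib vector_smult_assoc)
  then show ?thesis
    unfolding chart_inv_def v(2) by (metis cross2_perp[OF assms(1)] n proj_pt_scale)
qed

lemma open_Collect_cross2: "open {v. cross2 u v \<noteq> 0}"
  unfolding cross2_def by (intro open_Collect_neq continuous_intros)

lemma continuous_map_proj_pt:
  assumes "continuous_on S f" "\<And>x. x \<in> S \<Longrightarrow> f x \<noteq> 0"
  shows "continuous_map (top_of_set S) proj_line_top (\<lambda>x. proj_pt (f x))"
proof -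
  have "continuous_map (top_of_set S) (top_of_set (UNIV - {0})) f"
    using assms by (auto simp: continuous_map_in_subtopology)
  from continuous_map_compose[OF this quotient_imp_continuous_map[OF quotient_map_proj_line]]
  show ?thesis by (simp add: o_def)
qed

text \<open>Continuity of \<open>chart\<close> is tested on vectors: over the open complement of
  \<open>proj_pt u\<close> the class map is still a quotient map, and upstairs the chart is a ratio
  of linear forms with nonvanishing denominator.\<close>

lemma homeomorphic_maps_chart:
  assumes "u \<noteq> 0"
  shows "homeomorphic_maps (subtopology proj_line_top (proj_line - {proj_pt u})) euclidean (chart u) (chart_inv u)"
proof -
  let ?V = "{v. cross2 u v \<noteq> 0}"
  have V: "{x \<in> topspace (top_of_set (UNIV - {0})). proj_pt x \<in> proj_line - {proj_pt u}} = ?V"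
  proof -
    have "cross2 u 0 = 0" by (simp add: cross2_def)
    then have "v \<noteq> 0 \<and> proj_pt v \<in> proj_line - {proj_pt u} \<longleftrightarrow> cross2 u v \<noteq> 0" for v
      using proj_pt_eq_iff[OF assms, of v] proj_pt_in_proj_line[of v] by (cases "v = 0") auto
    then show ?thesis
      by (simp add: set_eq_iff)
  qed
  have sub: "{v. cross2 u v \<noteq> 0} \<subseteq> UNIV - {0}"
    by (auto simp: cross2_def)
  have "openin proj_line_top (proj_line - {proj_pt u})"
    using V open_Collect_cross2[of u] by (simp add: openin_proj_line_top)
  then have "quotient_map (subtopology (top_of_set (UNIV - {0})) ?V)
      (subtopology proj_line_top (proj_line - {proj_pt u})) proj_pt"
    by (rule quotient_map_restriction[OF quotient_map_proj_line V disjI1])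
  then have q: "quotient_map (top_of_set ?V) (subtopology proj_line_top (proj_line - {proj_pt u})) proj_pt"
    using sub by (simp add: subtopology_subtopology Int_absorb1)
  have "continuous_map (top_of_set ?V) euclidean (\<lambda>v. cross2 v (perp u) / cross2 u v)"
    unfolding cross2_def by (simp, intro continuous_intros) auto
  then have "continuous_map (top_of_set ?V) euclidean (chart u \<circ> proj_pt)"
  proof (rule continuous_map_eq)
    fix v assume "v \<in> topspace (top_of_set ?V)"
    then have "v \<noteq> 0" using sub by auto
    then show "cross2 v (perp u) / cross2 u v = (chart u \<circ> proj_pt) v"
      by (simp add: chart_proj_pt)
  qed
  then have "continuous_map (subtopology proj_line_top (proj_line - {proj_pt u})) euclidean (chart u)"
    by (rule continuous_compose_quotient_map[OF q])
  moreover have "continuous_map euclidean (subtopology proj_line_top (proj_line - {proj_pt u})) (chart_inv u)"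
  proof (rule continuous_map_into_subtopology)
    have "continuous_on UNIV (\<lambda>t. t *s u + perp u)"
      unfolding vector_scalar_mult_def
      by (intro continuous_intros continuous_on_vec_lambda)
    from continuous_map_proj_pt[OF this chart_inv_vector_nonzero[OF assms]]
    show "continuous_map euclidean proj_line_top (chart_inv u)"
      by (simp add: chart_inv_def[abs_def])
  qed (use chart_inv_in[OF assms] in auto)
  ultimately show ?thesis
    using assms by (auto simp: homeomorphic_maps_def topspace_proj_line_top chart_inv_chart chart_chart_inv)
qed

section \<open>Homographies as a group action, and their fixed points\<close>

lemma PGL2_cases:
  assumes "g \<in> carrier PGL2"
  obtains A where "invertible A" "g = scalars2 #>\<^bsub>GL2\<^esub> A"
proof -
  have "g \<in> (\<lambda>x. scalars2 #>\<^bsub>GL2\<^esub> x) ` carrier GL2"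
    using assms by (simp add: PGL2_def carrier_FactGroup)
  then show ?thesis using that by (auto simp: GL2_def)
qed

lemma invertible_mult_nonzero:
  fixes A :: "complex^2^2"
  assumes "invertible A" "v \<noteq> 0"
  shows "A *v v \<noteq> 0"
  using assms by (metis invertible_def matrix_vector_mul_assoc matrix_vector_mul_lid matrix_vector_mult_0_right)

lemma homography_in_proj_line:
  assumes "g \<in> carrier PGL2" "p \<in> proj_line"
  shows "homography g p \<in> proj_line"
proof -
  obtain A v where "invertible A" "g = scalars2 #>\<^bsub>GL2\<^esub> A" "v \<noteq> 0" "p = proj_pt v"
    using assms PGL2_cases proj_line_cases by metis
  then show ?thesis
    by (simp add: homography_class proj_pt_in_proj_line invertible_mult_nonzero)
qed

lemma homography_one:
  assumes "p \<in> proj_line"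
  shows "homography \<one>\<^bsub>PGL2\<^esub> p = p"
proof -
  interpret group GL2 by (rule group_GL2)
  obtain v where v: "v \<noteq> 0" "p = proj_pt v"
    using assms by (rule proj_line_cases)
  have "scalars2 #>\<^bsub>GL2\<^esub> \<one>\<^bsub>GL2\<^esub> = scalars2"
    using normal_imp_subgroup[OF scalars2_normal] by (intro coset_mult_one subgroup.subset)
  then have "\<one>\<^bsub>PGL2\<^esub> = scalars2 #>\<^bsub>GL2\<^esub> mat 1"
    by (simp add: PGL2_def) (simp add: GL2_def)
  moreover have "invertible (mat 1 :: complex^2^2)"
    by (auto simp: invertible_def)
  ultimately show ?thesis
    using v by (simp add: homography_class)
qed

lemma homography_mult:
  assumes "g \<in> carrier PGL2" "h \<in> carrier PGL2" "p \<in> proj_line"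
  shows "homography (g \<otimes>\<^bsub>PGL2\<^esub> h) p = homography g (homography h p)"
proof -
  interpret normal scalars2 GL2 by (rule scalars2_normal)
  obtain A where A: "invertible A" "g = scalars2 #>\<^bsub>GL2\<^esub> A"
    using assms(1) by (rule PGL2_cases)
  obtain C where C: "invertible C" "h = scalars2 #>\<^bsub>GL2\<^esub> C"
    using assms(2) by (rule PGL2_cases)
  obtain v where v: "v \<noteq> 0" "p = proj_pt v"
    using assms(3) by (rule proj_line_cases)
  have "g \<otimes>\<^bsub>PGL2\<^esub> h = scalars2 #>\<^bsub>GL2\<^esub> (A \<otimes>\<^bsub>GL2\<^esub> C)"
    using A C rcos_sum[of A C] by (simp add: PGL2_def) (simp add: GL2_def)
  then have "g \<otimes>\<^bsub>PGL2\<^esub> h = scalars2 #>\<^bsub>GL2\<^esub> (A ** C)"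
    by (simp add: GL2_def)
  then show ?thesis
    using A C v by (simp add: homography_class invertible_mult invertible_mult_nonzero matrix_vector_mul_assoc)
qed

lemma homography_inv_eq:
  assumes "g \<in> carrier PGL2" "q \<in> proj_line" "p = homography g q"
  shows "q = homography (inv\<^bsub>PGL2\<^esub> g) p"
proof -
  interpret group PGL2 by (rule group_PGL2)
  show ?thesis
    using assms homography_mult[of "inv\<^bsub>PGL2\<^esub> g" g q] by (simp add: homography_one)
qed

lemma continuous_map_homography:
  assumes "g \<in> carrier PGL2"
  shows "continuous_map proj_line_top proj_line_top (homography g)"
proof -
  obtain A where A: "invertible A" "g = scalars2 #>\<^bsub>GL2\<^esub> A"
    using assms by (rule PGL2_cases)
  have "continuous_map (top_of_set (UNIV - {0})) proj_line_top (\<lambda>v. proj_pt (A *v v))"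
    using A(1) invertible_mult_nonzero[of A]
    by (intro continuous_map_proj_pt matrix_vector_mult_linear_continuous_on) simp
  then have "continuous_map (top_of_set (UNIV - {0})) proj_line_top (homography g \<circ> proj_pt)"
    by (rule continuous_map_eq) (use A in \<open>auto simp: homography_class\<close>)
  then show ?thesis
    by (rule continuous_compose_quotient_map[OF quotient_map_proj_line])
qed

text \<open>The quadratic formula produces a root of the characteristic polynomial; if the lower
  left entry vanishes, the first basis vector is already an eigenvector.\<close>

lemma complex_eigenvector_exists:
  fixes A :: "complex^2^2"
  obtains l v where "v \<noteq> 0" "A *v v = l *s v"
proof (cases "A$2$1 = 0")
  case True
  have "A *v (\<chi> i. if i = 1 then 1 else 0) = A$1$1 *s (\<chi> i. if i = 1 then 1 else 0)"
    using True by (simp add: vec_eq_iff forall_2 matrix_vector_mult_def sum_2)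
  then show ?thesis
    by (rule that[rotated]) (simp add: vec_eq_iff forall_2)
next
  case False
  define a b c d where "a = A$1$1" and "b = A$1$2" and "c = A$2$1" and "d = A$2$2"
  \<comment> \<open>The square root of the discriminant of the characteristic polynomial: (a - d)^2
    + 4bc = (a + d)^2 - 4(ad - bc).\<close>
  define s where "s = csqrt ((a - d)\<^sup>2 + 4 * b * c)"
  define l where "l = (a + d + s) / 2"
  have l2: "2 * l - 2 * a = s + d - a" "2 * l - 2 * d = s + a - d"
    by (simp_all add: l_def field_simps)
  have "4 * ((l - a) * (l - d)) = (2 * l - 2 * a) * (2 * l - 2 * d)"
    by (simp add: algebra_simps)
  also have "\<dots> = s\<^sup>2 - (a - d)\<^sup>2"
    unfolding l2 by (simp add: power2_eq_square algebra_simps)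
  also have "\<dots> = 4 * (b * c)"
    by (simp add: s_def)
  finally have "(l - a) * (l - d) = b * c"
    by simp
  then have "a * (l - d) + b * c = l * (l - d)"
    by (simp add: algebra_simps)
  then have "A$1$1 * (l - A$2$2) + A$1$2 * A$2$1 = l * (l - A$2$2)"
    by (simp add: a_def b_def c_def d_def)
  \<comment> \<open>The second row holds for any scalar \<open>l\<close>; the first is the
    characteristic equation.\<close>
  then have "A *v (\<chi> i. if i = 1 then l - A$2$2 else A$2$1) = l *s (\<chi> i. if i = 1 then l - A$2$2 else A$2$1)"
    by (simp add: vec_eq_iff forall_2 matrix_vector_mult_def sum_2 algebra_simps)
  then show ?thesis
    by (rule that[rotated]) (use False in \<open>simp add: vec_eq_iff forall_2\<close>)
qed

text \<open>The line spanned by an eigenvector of a representing matrix is fixed; invertibility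
  rules out the eigenvalue 0.\<close>

lemma homography_has_fixed_point:
  assumes "g \<in> carrier PGL2"
  obtains p where "p \<in> proj_line" "homography g p = p"
proof -
  obtain A where A: "invertible A" "g = scalars2 #>\<^bsub>GL2\<^esub> A"
    using assms by (rule PGL2_cases)
  obtain l v where v: "v \<noteq> 0" "A *v v = l *s v"
    by (rule complex_eigenvector_exists)
  have "l \<noteq> 0"
    using invertible_mult_nonzero[OF A(1) v(1)] v(2) by auto
  show ?thesis
  proof
    show "proj_pt v \<in> proj_line" using v by (simp add: proj_pt_in_proj_line)
    show "homography g (proj_pt v) = proj_pt v"
      using A v \<open>l \<noteq> 0\<close> by (simp add: homography_class proj_pt_scale)
  qed
qed

section \<open>Orbit configuration spaces\<close>

locale orbit_configuration =
  fixes G :: "(complex^2^2) set set" and Z :: "(complex^2) set set"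
  assumes subgroup_G: "subgroup G PGL2"
    and finite_G: "finite G"
    and Z_proj: "Z \<subseteq> proj_line"
    and finite_Z: "finite Z"
    and Z_stable: "\<And>g p. g \<in> G \<Longrightarrow> p \<in> Z \<Longrightarrow> homography g p \<in> Z"
    and stabilizer_nontrivial: "\<And>p. p \<in> proj_line \<Longrightarrow>
           stabilizer (PGL2\<lparr>carrier := G\<rparr>) homography p \<noteq> {\<one>\<^bsub>PGL2\<^esub>} \<Longrightarrow> p \<in> Z"
begin

lemma G_carrier: "g \<in> G \<Longrightarrow> g \<in> carrier PGL2"
  using subgroup.mem_carrier[OF subgroup_G] .

lemma G_inv: "g \<in> G \<Longrightarrow> inv\<^bsub>PGL2\<^esub> g \<in> G"
  using subgroup.m_inv_closed[OF subgroup_G] .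

lemma homography_complement:
  assumes "g \<in> G" "p \<in> proj_line - Z"
  shows "homography g p \<in> proj_line - Z"
proof -
  have "homography g p \<notin> Z"
    using homography_inv_eq[OF G_carrier[OF assms(1)], of p "homography g p"]
      Z_stable[OF G_inv[OF assms(1)], of "homography g p"] assms(2) by auto
  then show ?thesis
    using assms by (auto intro: homography_in_proj_line G_carrier)
qed

lemma homography_sym:
  assumes "g \<in> G" "p \<in> proj_line" "q \<in> proj_line" "p = homography g q"
  shows "\<exists>h\<in>G. q = homography h p"
  using homography_inv_eq[OF G_carrier[OF assms(1)] assms(3,4)] G_inv[OF assms(1)] by blast

text \<open>If \<open>g\<close> and \<open>h\<close> agree at a point, their quotient fixes it;
  outside \<open>Z\<close> stabilizers are trivial, so \<open>G\<close> acts freely there.\<close>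

lemma homography_free:
  assumes "g \<in> G" "h \<in> G" "p \<in> proj_line - Z" "homography g p = homography h p"
  shows "g = h"
proof -
  interpret group PGL2 by (rule group_PGL2)
  let ?k = "inv\<^bsub>PGL2\<^esub> h \<otimes>\<^bsub>PGL2\<^esub> g"
  have k: "?k \<in> G"
    using assms(1,2) by (intro subgroup.m_closed[OF subgroup_G] G_inv)
  have "homography ?k p = homography (inv\<^bsub>PGL2\<^esub> h) (homography h p)"
    using assms G_carrier by (subst homography_mult) auto
  also have "\<dots> = p"
    using homography_inv_eq[OF G_carrier[OF assms(2)], of p] assms(3) by simp
  finally have "?k \<in> stabilizer (PGL2\<lparr>carrier := G\<rparr>) homography p"
    using k by (simp add: stabilizer_def)
  moreover have "stabilizer (PGL2\<lparr>carrier := G\<rparr>) homography p = {\<one>\<^bsub>PGL2\<^esub>}"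
    using stabilizer_nontrivial[of p] assms(3) by blast
  ultimately have "?k = \<one>\<^bsub>PGL2\<^esub>"
    by blast
  then have "g = inv\<^bsub>PGL2\<^esub> (inv\<^bsub>PGL2\<^esub> h)"
    using assms(1,2) G_carrier by (metis inv_closed inv_equality inv_inv l_inv r_inv inv_solve_left' r_one)
  then show ?thesis
    using assms(2) G_carrier by simp
qed

text \<open>A nontrivial element and the identity agree at a fixed point of that element, which
  freeness excludes outside \<open>Z\<close>.\<close>

lemma Z_nonempty:
  assumes "G \<noteq> {\<one>\<^bsub>PGL2\<^esub>}"
  shows "Z \<noteq> {}"
proof -
  have one: "\<one>\<^bsub>PGL2\<^esub> \<in> G"
    by (rule subgroup.one_closed[OF subgroup_G])
  with assms obtain g where g: "g \<in> G" "g \<noteq> \<one>\<^bsub>PGL2\<^esub>"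
    by blast
  obtain p where p: "p \<in> proj_line" "homography g p = p"
    by (rule homography_has_fixed_point[OF G_carrier[OF g(1)]])
  have "homography g p = homography \<one>\<^bsub>PGL2\<^esub> p"
    using p homography_one by simp
  then have "p \<in> Z"
    using homography_free[OF g(1) one, of p] p(1) g(2) by blast
  then show ?thesis by blast
qed

section \<open>Configurations built point by point\<close>

definition conf :: "nat \<Rightarrow> (nat \<Rightarrow> (complex^2) set) set" where
  "conf n = {p \<in> {1..n} \<rightarrow>\<^sub>E (proj_line - Z).
          \<forall>i\<in>{1..n}. \<forall>j\<in>{1..n}. i \<noteq> j \<longrightarrow> (\<forall>g\<in>G. p i \<noteq> homography g (p j))}"

lemma orbit_conf_space_eq:
  "orbit_conf_space G Z n = subtopology (product_topology (\<lambda>_. proj_line_top) {1..n}) (conf n)"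
  by (simp add: orbit_conf_space_def conf_def)

lemma topspace_orbit_conf_space: "topspace (orbit_conf_space G Z n) = conf n"
proof -
  have "conf n \<subseteq> {1..n} \<rightarrow>\<^sub>E (proj_line - Z)"
    by (simp add: conf_def)
  also have "\<dots> \<subseteq> {1..n} \<rightarrow>\<^sub>E proj_line"
    by (rule PiE_mono) simp
  finally show ?thesis
    by (simp add: orbit_conf_space_eq topspace_proj_line_top Int_absorb1)
qed

lemma conf_mem: "\<lbrakk>p \<in> conf n; i \<in> {1..n}\<rbrakk> \<Longrightarrow> p i \<in> proj_line - Z"
  unfolding conf_def by (blast dest: PiE_mem)

text \<open>Only the conditions on the last point are new: it avoids \<open>Z\<close> and the orbits
  of the earlier points. That an earlier point also avoids the orbit of the last one follows by
  inverting the group element.\<close>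

lemma conf_Suc_iff:
  "p \<in> conf (Suc n) \<longleftrightarrow>
     p \<in> extensional {1..Suc n} \<and> restrict p {1..n} \<in> conf n \<and> p (Suc n) \<in> proj_line - Z \<and>
     (\<forall>g\<in>G. \<forall>i\<in>{1..n}. p (Suc n) \<noteq> homography g (p i))"
  (is "_ \<longleftrightarrow> ?R")
proof
  assume "p \<in> conf (Suc n)"
  then show ?R
    by (auto simp: conf_def PiE_iff)
next
  assume R: ?R
  have mem: "p i \<in> proj_line - Z" if "i \<in> {1..Suc n}" for i
    using R that conf_mem[of "restrict p {1..n}" n i] by (cases "i = Suc n") auto
  have "p i \<noteq> homography g (p j)"
    if ij: "i \<in> {1..Suc n}" "j \<in> {1..Suc n}" "i \<noteq> j" "g \<in> G" for i j g
  proof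
    assume eq: "p i = homography g (p j)"
    have "i = Suc n \<or> i \<in> {1..n}" "j = Suc n \<or> j \<in> {1..n}" "i \<noteq> j"
      using ij(1-3) by auto
    then consider "i = Suc n" "j \<in> {1..n}" | "j = Suc n" "i \<in> {1..n}" | "i \<in> {1..n}" "j \<in> {1..n}"
      by blast
    then show False
    proof cases
      case 1
      then show False using R eq ij(4) by blast
    next
      case 2
      obtain h where "h \<in> G" "p j = homography h (p i)"
        using homography_sym[OF ij(4) _ _ eq] mem[OF ij(1)] mem[OF ij(2)] by blast
      then show False using R 2 by blast
    next
      case 3
      then show False
        using R eq ij(3,4) by (auto simp: conf_def)
    qed
  qed
  then show "p \<in> conf (Suc n)"
    using R mem by (simp add: conf_def PiE_iff)
qed

lemma continuous_map_conf_coordinate: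
  assumes "i \<in> {1..n}"
  shows "continuous_map (orbit_conf_space G Z n) proj_line_top (\<lambda>p. p i)"
  unfolding orbit_conf_space_eq
  using assms by (intro continuous_map_from_subtopology continuous_map_product_projection)

end

text \<open>Taking a point of \<open>Z\<close> as infinity puts every coordinate of a configuration,
  and all its translates under \<open>G\<close>, into one affine chart.\<close>

locale orbit_configuration_chart = orbit_configuration +
  fixes u :: "complex^2"
  assumes u_nonzero: "u \<noteq> 0" and u_in_Z: "proj_pt u \<in> Z"
begin

text \<open>The forbidden values for a further point: \<open>Inl\<close> marks a point of
  \<open>Z\<close> other than infinity, giving a constant section, and \<open>Inr (g, i)\<close> the
  translate by \<open>g\<close> of the \<open>i\<close>-th point.\<close>

fun puncture :: "(complex^2) set + (complex^2^2) set \<times> nat \<Rightarrow> (nat \<Rightarrow> (complex^2) set) \<Rightarrow> complex" where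
  "puncture (Inl q) b = chart u q"
| "puncture (Inr (g, i)) b = chart u (homography g (b i))"

definition punctures :: "nat \<Rightarrow> ((complex^2) set + (complex^2^2) set \<times> nat) set" where
  "punctures n = (Z - {proj_pt u}) <+> (G \<times> {1..n})"

lemma finite_punctures: "finite (punctures n)"
  using finite_Z finite_G by (simp add: punctures_def)

text \<open>The number \<alpha> with index \<open>n + 1\<close>, which enters when a point is added
  to \<open>n\<close> points. The -1 accounts for infinity; integers avoid truncated
  subtraction.\<close>

lemma card_punctures: "int (card (punctures n)) = int (card G) * int n + int (card Z) - 1"
proof -
  have "card Z \<ge> 1"
    using u_in_Z finite_Z by (metis card_gt_0_iff One_nat_def Suc_leI empty_iff)
  then show ?thesis
    using finite_Z finite_G u_in_Z by (simp add: punctures_def card_Plus card_cartesian_product)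
qed

lemma chart_eq_iff:
  assumes "p \<in> proj_line - {proj_pt u}" "q \<in> proj_line - {proj_pt u}"
  shows "chart u p = chart u q \<longleftrightarrow> p = q"
  using chart_inv_chart[OF u_nonzero] assms by metis

lemma complement_chart: "q \<in> proj_line - Z \<Longrightarrow> q \<in> proj_line - {proj_pt u}"
  using u_in_Z by blast

lemma continuous_map_chart:
  assumes "continuous_map X proj_line_top f" "\<And>x. x \<in> topspace X \<Longrightarrow> f x \<in> proj_line - {proj_pt u}"
  shows "continuous_map X euclidean (\<lambda>x. chart u (f x))"
proof -
  have "continuous_map X (subtopology proj_line_top (proj_line - {proj_pt u})) f"
    using assms by (auto simp: continuous_map_in_subtopology)
  moreover have "continuous_map (subtopology proj_line_top (proj_line - {proj_pt u})) euclidean (chart u)"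
    using homeomorphic_maps_chart[OF u_nonzero] by (simp add: homeomorphic_maps_def)
  ultimately show ?thesis
    by (rule continuous_map_compose[unfolded o_def])
qed

lemma continuous_map_puncture:
  assumes "x \<in> punctures n"
  shows "continuous_map (orbit_conf_space G Z n) euclidean (puncture x)"
proof (cases x)
  case (Inl q)
  then have "puncture x = (\<lambda>b. chart u q)"
    by (simp add: fun_eq_iff)
  then show ?thesis by simp
next
  case (Inr gi)
  obtain g i where x: "x = Inr (g, i)" "g \<in> G" "i \<in> {1..n}"
    using assms Inr by (cases gi) (auto simp: punctures_def)
  have "continuous_map (orbit_conf_space G Z n) proj_line_top (\<lambda>p. homography g (p i))"
    by (rule continuous_map_compose[unfolded o_def, OF continuous_map_conf_coordinate[OF x(3)]
          continuous_map_homography[OF G_carrier[OF x(2)]]])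
  then have "continuous_map (orbit_conf_space G Z n) euclidean (\<lambda>p. chart u (homography g (p i)))"
  proof (rule continuous_map_chart)
    fix p assume "p \<in> topspace (orbit_conf_space G Z n)"
    then show "homography g (p i) \<in> proj_line - {proj_pt u}"
      by (intro complement_chart homography_complement x(2) conf_mem[OF _ x(3)])
        (simp add: topspace_orbit_conf_space)
  qed
  moreover have "puncture x = (\<lambda>p. chart u (homography g (p i)))"
    using x(1) by (simp add: fun_eq_iff)
  ultimately show ?thesis
    by simp
qed

text \<open>Points of \<open>Z\<close> are told apart by their index, and they differ from
  translates because the complement of \<open>Z\<close> is stable. Translates of one point differ by
  freeness; a coincidence between translates of two points would put both in one orbit.\<close>

lemma puncture_distinct:
  assumes "x \<in> punctures n" "y \<in> punctures n" "x \<noteq> y" "b \<in> conf n"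
  shows "puncture x b \<noteq> puncture y b"
proof -
  \<comment> \<open>The projective point behind each puncture. The chart is injective away from
    infinity, so the comparison takes place in the projective line.\<close>
  define pos where "pos = (\<lambda>x. case x of Inl q \<Rightarrow> q | Inr (g, i) \<Rightarrow> homography g (b i))"
  have pos: "puncture x b = chart u (pos x)" for x
    by (cases "(x, b)" rule: puncture.cases) (simp_all add: pos_def)
  have posL: "pos (Inl q) \<in> Z - {proj_pt u}" if "Inl q \<in> punctures n" for q
    using that by (auto simp: pos_def punctures_def)
  have posR: "pos (Inr (g, i)) \<in> proj_line - Z" if "Inr (g, i) \<in> punctures n" for g i
  proof -
    have "g \<in> G" "i \<in> {1..n}"
      using that by (auto simp: punctures_def)
    then show ?thesis
      using homography_complement conf_mem[OF assms(4)] by (simp add: pos_def)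
  qed
  have mem: "pos x \<in> proj_line - {proj_pt u}" if "x \<in> punctures n" for x
  proof (cases x)
    case (Inl q)
    then show ?thesis using posL[of q] that Z_proj by auto
  next
    case (Inr gi)
    then show ?thesis using posR[of "fst gi" "snd gi"] that complement_chart by auto
  qed
  have "pos x \<noteq> pos y"
  proof
    assume eq: "pos x = pos y"
    show False
    proof (cases x; cases y)
      fix q q' assume "x = Inl q" "y = Inl q'"
      then show False using eq assms(3) by (simp add: pos_def)
    next
      fix q gi assume "x = Inl q" "y = Inr gi"
      then show False using eq posL[of q] posR[of "fst gi" "snd gi"] assms(1,2) by auto
    next
      fix q gi assume "x = Inr gi" "y = Inl q"
      then show False using eq posL[of q] posR[of "fst gi" "snd gi"] assms(1,2) by auto
    next
      fix gi hj assume "x = Inr gi" "y = Inr hj"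
      then obtain g i h j where x: "x = Inr (g, i)" and y: "y = Inr (h, j)"
        by (metis surj_pair)
      have gh: "g \<in> G" "h \<in> G" and ij: "i \<in> {1..n}" "j \<in> {1..n}"
        using assms(1,2) x y by (auto simp: punctures_def)
      have b: "b i \<in> proj_line - Z" "b j \<in> proj_line - Z"
        using conf_mem[OF assms(4)] ij by auto
      have e: "homography g (b i) = homography h (b j)"
        using eq x y by (simp add: pos_def)
      show False
      proof (cases "i = j")
        case True
        then show False
          using homography_free[OF gh b(1)] e x y assms(3) by simp
      next
        case False
        interpret group PGL2 by (rule group_PGL2)
        have "b i = homography (inv\<^bsub>PGL2\<^esub> g) (homography h (b j))"
          using homography_inv_eq[OF G_carrier[OF gh(1)], of "b i" "homography h (b j)"] b e by simp
        also have "\<dots> = homography (inv\<^bsub>PGL2\<^esub> g \<otimes>\<^bsub>PGL2\<^esub> h) (b j)"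
          using gh b G_carrier by (subst homography_mult) auto
        finally have "b i = homography (inv\<^bsub>PGL2\<^esub> g \<otimes>\<^bsub>PGL2\<^esub> h) (b j)" .
        moreover have "inv\<^bsub>PGL2\<^esub> g \<otimes>\<^bsub>PGL2\<^esub> h \<in> G"
          using gh by (intro subgroup.m_closed[OF subgroup_G] G_inv)
        ultimately show False
          using assms(4) ij False unfolding conf_def by blast
      qed
    qed
  qed
  then show ?thesis
    using mem assms(1,2) by (simp add: pos chart_eq_iff)
qed

lemma puncture_avoid_iff:
  assumes "b \<in> conf n" "q \<in> proj_line - {proj_pt u}"
  shows "(\<forall>x\<in>punctures n. chart u q \<noteq> puncture x b) \<longleftrightarrow>
    q \<notin> Z \<and> (\<forall>g\<in>G. \<forall>i\<in>{1..n}. q \<noteq> homography g (b i))"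
proof -
  have "chart u q = chart u q' \<longleftrightarrow> q = q'" if "q' \<in> Z - {proj_pt u}" for q'
    using that Z_proj assms(2) by (intro chart_eq_iff) auto
  moreover have "chart u q = chart u (homography g (b i)) \<longleftrightarrow> q = homography g (b i)"
    if "g \<in> G" "i \<in> {1..n}" for g i
    by (intro chart_eq_iff assms complement_chart homography_complement conf_mem[OF assms(1)] that)
  moreover have "punctures n = Inl ` (Z - {proj_pt u}) \<union> Inr ` (G \<times> {1..n})"
    by (auto simp: punctures_def)
  ultimately show ?thesis
    using assms(2) by (auto simp: ball_Un)
qed

text \<open>The last point is recorded by its affine coordinate, and the inverse map appends the
  point with the given coordinate. The values which that coordinate must avoid are exactly the
  punctures.\<close>

lemma orbit_conf_space_Suc:
  "orbit_conf_space G Z (Suc n) homeomorphic_space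
   subtopology (prod_topology (orbit_conf_space G Z n) euclidean)
     (punctured_bundle (orbit_conf_space G Z n) puncture (punctures n))"
proof -
  let ?X = "orbit_conf_space G Z" and ?E = "punctured_bundle (orbit_conf_space G Z n) puncture (punctures n)"
  let ?f = "\<lambda>p. (restrict p {1..n}, chart u (p (Suc n)))"
  let ?g = "\<lambda>w. (fst w)(Suc n := chart_inv u (snd w))"
  have E: "w \<in> ?E \<longleftrightarrow> fst w \<in> conf n \<and> (\<forall>x\<in>punctures n. snd w \<noteq> puncture x (fst w))" for w
    by (simp add: punctured_bundle_def topspace_orbit_conf_space)
  have f_in: "?f p \<in> ?E" if "p \<in> conf (Suc n)" for p
    using that puncture_avoid_iff[of "restrict p {1..n}" n "p (Suc n)"] complement_chart[of "p (Suc n)"]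
    unfolding E conf_Suc_iff by auto
  have g_in: "?g w \<in> conf (Suc n)" if "w \<in> ?E" for w
  proof -
    have w: "fst w \<in> conf n" "\<forall>x\<in>punctures n. snd w \<noteq> puncture x (fst w)"
      using that by (auto simp: E)
    then have ext: "fst w \<in> extensional {1..n}"
      by (simp add: conf_def PiE_iff)
    have r: "restrict (?g w) {1..n} = fst w"
      using ext by (auto simp: fun_eq_iff extensional_def)
    have c: "chart_inv u (snd w) \<notin> Z \<and>
       (\<forall>g\<in>G. \<forall>i\<in>{1..n}. chart_inv u (snd w) \<noteq> homography g (fst w i))"
      using puncture_avoid_iff[OF w(1) chart_inv_in[OF u_nonzero, of "snd w"]] w(2)
      by (simp add: chart_chart_inv[OF u_nonzero])
    have "?g w \<in> extensional {1..Suc n}"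
      using ext by (auto simp: extensional_def)
    then show ?thesis
      unfolding conf_Suc_iff r using w(1) c chart_inv_in[OF u_nonzero, of "snd w"] by auto
  qed
  have "continuous_map (?X (Suc n)) (subtopology (prod_topology (?X n) euclidean) ?E) ?f"
  proof (rule continuous_map_into_subtopology)
    show "?f \<in> topspace (?X (Suc n)) \<rightarrow> ?E"
      using f_in by (auto simp: topspace_orbit_conf_space)
    have "continuous_map (?X (Suc n)) (?X n) (\<lambda>p. restrict p {1..n})"
      unfolding orbit_conf_space_eq[of n]
    proof (rule continuous_map_into_subtopology)
      show "(\<lambda>p. restrict p {1..n}) \<in> topspace (?X (Suc n)) \<rightarrow> conf n"
        by (auto simp: topspace_orbit_conf_space conf_Suc_iff)
      have "continuous_map (?X (Suc n)) proj_line_top (\<lambda>p. restrict p {1..n} k)" if "k \<in> {1..n}" for k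
        using that continuous_map_conf_coordinate[of k "Suc n"] by simp
      then show "continuous_map (?X (Suc n)) (product_topology (\<lambda>_. proj_line_top) {1..n}) (\<lambda>p. restrict p {1..n})"
        by (auto simp: continuous_map_componentwise)
    qed
    moreover have "continuous_map (?X (Suc n)) euclidean (\<lambda>p. chart u (p (Suc n)))"
    proof (rule continuous_map_chart)
      show "continuous_map (?X (Suc n)) proj_line_top (\<lambda>p. p (Suc n))"
        by (rule continuous_map_conf_coordinate) simp
      show "p (Suc n) \<in> proj_line - {proj_pt u}" if "p \<in> topspace (?X (Suc n))" for p
        using that by (intro complement_chart) (simp add: topspace_orbit_conf_space conf_Suc_iff)
    qed
    ultimately show "continuous_map (?X (Suc n)) (prod_topology (?X n) euclidean) ?f"
      by (rule continuous_map_pairedI)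
  qed
  moreover have "continuous_map (subtopology (prod_topology (?X n) euclidean) ?E) (?X (Suc n)) ?g"
    unfolding orbit_conf_space_eq[of "Suc n"]
  proof (rule continuous_map_into_subtopology)
    let ?T = "subtopology (prod_topology (?X n) (euclidean :: complex topology)) ?E"
    have top: "topspace ?T \<subseteq> ?E" by simp
    show g_fun: "?g \<in> topspace ?T \<rightarrow> conf (Suc n)"
      using g_in top by blast
    have "continuous_map ?T proj_line_top (\<lambda>w. ?g w k)" if k: "k \<in> {1..Suc n}" for k
    proof (cases "k = Suc n")
      case True
      have "continuous_map euclidean proj_line_top (chart_inv u)"
        using homeomorphic_maps_chart[OF u_nonzero]
        by (simp add: homeomorphic_maps_def continuous_map_in_subtopology)
      from continuous_map_compose[OF continuous_map_subtopology_snd this]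
      show ?thesis using True by (simp add: o_def)
    next
      case False
      then have "continuous_map (?X n) proj_line_top (\<lambda>p. p k)"
        using k by (intro continuous_map_conf_coordinate) auto
      from continuous_map_compose[OF continuous_map_subtopology_fst this]
      show ?thesis using False by (simp add: o_def)
    qed
    \<comment> \<open>Points of a product topology are \<open>undefined\<close> outside the index
      set, so continuity by components also asks for this.\<close>
    moreover have "?g ` topspace ?T \<subseteq> extensional {1..Suc n}"
    proof -
      have "?g ` topspace ?T \<subseteq> conf (Suc n)"
        using g_fun by (simp only: image_subset_iff_funcset)
      also have "\<dots> \<subseteq> extensional {1..Suc n}"
        by (auto simp: conf_Suc_iff)
      finally show ?thesis .
    qed
    ultimately show "continuous_map ?T (product_topology (\<lambda>_. proj_line_top) {1..Suc n}) ?g"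
      by (simp only: continuous_map_componentwise) blast
  qed
  moreover have "?g (?f p) = p" if "p \<in> conf (Suc n)" for p
  proof -
    have p: "p \<in> extensional {1..Suc n}" "p (Suc n) \<in> proj_line - {proj_pt u}"
      using that complement_chart by (auto simp: conf_Suc_iff)
    then show ?thesis
      using chart_inv_chart[OF u_nonzero p(2)] by (auto simp: fun_eq_iff extensional_def le_Suc_eq)
  qed
  moreover have "?f (?g w) = w" if "w \<in> ?E" for w
  proof -
    have "fst w \<in> extensional {1..n}"
      using that by (simp add: E conf_def PiE_iff)
    then have "restrict (?g w) {1..n} = fst w"
      by (auto simp: fun_eq_iff extensional_def)
    then show ?thesis
      by (simp add: chart_chart_inv[OF u_nonzero])
  qed
  ultimately have "homeomorphic_maps (?X (Suc n)) (subtopology (prod_topology (?X n) euclidean) ?E) ?f ?g"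
    unfolding homeomorphic_maps_def by (simp only: topspace_orbit_conf_space topspace_subtopology) blast
  then show ?thesis
    unfolding homeomorphic_space_def by blast
qed

section \<open>Ranks of the homology groups and coefficients of the product\<close>

definition poincare_product :: "nat \<Rightarrow> int fps" where
  "poincare_product n = (\<Prod>k=1..n. 1 + fps_const (int (card G) * (int k - 1) + int (card Z) - 1) * fps_X)"

text \<open>Multiplication by 1 + m X on coefficients, with m the number of punctures: the recursion
  that the ranks satisfy. Degree 0 is set apart because \<open>k - 1\<close> is truncated on
  naturals.\<close>

lemma poincare_product_Suc_nth:
  "fps_nth (poincare_product (Suc n)) k =
     fps_nth (poincare_product n) k + int (card (punctures n)) * (if k = 0 then 0 else fps_nth (poincare_product n) (k - 1))"
proof -
  have "poincare_product (Suc n) = poincare_product n + fps_const (int (card (punctures n))) * (poincare_product n * fps_X)"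
    by (simp add: poincare_product_def card_punctures algebra_simps)
  then show ?thesis by simp
qed

text \<open>Induction on \<open>n\<close> for all integer degrees at once, since degree
  \<open>k\<close> draws on degree \<open>k - 1\<close>; negative degrees have rank 0. At
  \<open>n = 0\<close> the space is a single point.\<close>

lemma free_of_rank_orbit_conf_space:
  "\<exists>r. free_of_rank (homology_group k (orbit_conf_space G Z n)) r \<and>
       int r = (if k < 0 then 0 else fps_nth (poincare_product n) (nat k))"
proof (induction n arbitrary: k)
  case 0
  have top: "topspace (orbit_conf_space G Z 0) = {\<lambda>_. undefined}"
    unfolding topspace_orbit_conf_space by (auto simp: conf_def)
  show ?case
  proof (cases "k = 0")
    case True
    have "path_connected_space (orbit_conf_space G Z 0)"
      by (intro contractible_imp_path_connected_space contractible_space_subset_singleton) (simp add: top)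
    then have "homology_group 0 (orbit_conf_space G Z 0) \<cong> integer_group"
      using isomorphic_integer_zeroth_homology_group top by (metis empty_iff insertI1)
    then show ?thesis
      using True free_of_rank_iso[OF _ free_of_rank_integer]
      by (intro exI[of _ 1]) (simp add: poincare_product_def)
  next
    case False
    then have "free_of_rank (homology_group k (orbit_conf_space G Z 0)) 0"
      by (intro free_of_rank_trivial homology_dimension_axiom[OF top]) auto
    then show ?thesis
      using False by (intro exI[of _ 0]) (simp add: poincare_product_def)
  qed
next
  case (Suc n)
  obtain r where r: "free_of_rank (homology_group k (orbit_conf_space G Z n)) r"
      "int r = (if k < 0 then 0 else fps_nth (poincare_product n) (nat k))"
    using Suc by blast
  obtain s where s: "free_of_rank (homology_group (k - 1) (orbit_conf_space G Z n)) s"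
      "int s = (if k - 1 < 0 then 0 else fps_nth (poincare_product n) (nat (k - 1)))"
    using Suc by blast
  \<comment> \<open>\<open>r\<close> is inherited from the base, and each puncture adds the rank
    \<open>s\<close> of degree \<open>k - 1\<close>.\<close>
  have "free_of_rank (homology_group k (orbit_conf_space G Z (Suc n))) (r + card (punctures n) * s)"
    by (rule free_of_rank_iso[OF homeomorphic_space_imp_isomorphic_homology_groups[OF orbit_conf_space_Suc]
          free_of_rank_punctured_bundle[OF finite_punctures _ _ r(1) s(1)]])
      (auto intro: continuous_map_puncture dest: puncture_distinct simp: topspace_orbit_conf_space)
  moreover have "int (r + card (punctures n) * s) = (if k < 0 then 0 else fps_nth (poincare_product (Suc n)) (nat k))"
    using r(2) s(2) by (auto simp: poincare_product_Suc_nth nat_diff_distrib)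
  ultimately show ?case by blast
qed

end

section \<open>The Poincare series read off from the ranks\<close>

theorem corollary4p8:
  fixes G :: "(complex^2^2) set set"
    and Z :: "(complex^2) set set"
    and n :: nat
  assumes "subgroup G PGL2"
    and "finite G"
    and "Z \<subseteq> proj_line"
    and "finite Z"
    and "\<And>g p. g \<in> G \<Longrightarrow> p \<in> Z \<Longrightarrow> homography g p \<in> Z"
    and "\<And>p. p \<in> proj_line \<Longrightarrow>
           stabilizer (PGL2\<lparr>carrier := G\<rparr>) homography p \<noteq> {\<one>\<^bsub>PGL2\<^esub>} \<Longrightarrow> p \<in> Z"
    and "(G, Z) \<noteq> ({\<one>\<^bsub>PGL2\<^esub>}, {})"
    and "n \<ge> 1"
  shows "finite_betti (orbit_conf_space G Z n) \<and>
    poincare_series (orbit_conf_space G Z n) =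
      (\<Prod>k=1..n. 1 + fps_const (int (card G) * (int k - 1) + int (card Z) - 1) * fps_X)"
proof -
  interpret orbit_configuration G Z
    by (rule orbit_configuration.intro) (fact assms)+
  \<comment> \<open>If \<open>G\<close> is trivial, the hypothesis on the pair excludes an empty
    \<open>Z\<close>; otherwise \<open>Z\<close> contains a fixed point of a nontrivial
    element.\<close>
  have "Z \<noteq> {}"
    using assms(7) Z_nonempty by auto
  then obtain u where "u \<noteq> 0" "proj_pt u \<in> Z"
    using assms(3) by (metis ex_in_conv proj_line_cases subsetD)
  then interpret orbit_configuration_chart G Z u
    by unfold_locales
  have rank: "\<exists>r. group_rank (homology_group (int k) (orbit_conf_space G Z n)) = enat r \<and>
      int r = fps_nth (poincare_product n) k" for k
    using free_of_rank_orbit_conf_space[of "int k" n] group_rank_free_of_rank[OF abelian_homology_group]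
    by auto
  then have "finite_betti (orbit_conf_space G Z n)"
    unfolding finite_betti_def by (metis enat.distinct(1))
  moreover have "poincare_series (orbit_conf_space G Z n) = poincare_product n"
  proof (rule fps_ext)
    fix k
    show "fps_nth (poincare_series (orbit_conf_space G Z n)) k = fps_nth (poincare_product n) k"
      using rank[of k] by (auto simp: poincare_series_def)
  qed
  ultimately show ?thesis
    by (simp add: poincare_product_def)
qed

end
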